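(* Let $A\in\mathbb{C}^{r\times r}$ be a positive stable matrix such that $A+kI$ is invertible for all integers $k\ge 0$. Let $x>0$ be real and $t\in\mathbb{C}$. Then for every integer $n\ge 1$, $$\frac{\partial^n}{\partial t^n}e\big((x,t);A\big)=e\big((x,t);A+nI\big),\qquad \frac{\partial^n}{\partial t^n}E\big((x,t);A\big)=E\big((x,t);A+nI\big),$$ and $$\frac{\partial}{\partial x}e\big((x,t);A\big)=x^{A-I}e^{-x}\,\Gamma^{-1}(A)\;{}_0F_1(-;A;tx),\qquad \frac{\partial}{\partial x}E\big((x,t);A\big)=-x^{A-I}e^{-x}\,\Gamma^{-1}(A)\;{}_0F_1(-;A;tx).$$
   Context: $\mathbb{C}^{r\times r}$ is the space of complex $r\times r$ matrices and $I$ is the identity matrix. A matrix $M$ is positive stable if every eigenvalue of $M$ has positive real part. For real $v>0$, $v^{M}=\exp(M\ln v)$. For positive stable $M$, $\Gamma(M)=\int_0^\infty e^{-s}s^{M-I}ds$, and $\Gamma^{-1}(M)$ is its matrix inverse. For $x>0$ and $M$ positive stable, $\gamma(M,x)=\int_0^x e^{-s}s^{M-I}ds$ and $\Gamma(M,x)=\int_x^\infty e^{-s}s^{M-I}ds$. The Pochhammer symbol is $(M)_0=I$, $(M)_m=M(M+I)\cdots(M+(m-1)I)$ for $m\ge1$, and $(M)_m^{-1}$ is its matrix inverse. Also ${}_0F_1(-;A;z)=\sum_{m=0}^\infty (A)_m^{-1}\frac{z^m}{m!}$. The incomplete exponential matrix functions are $$e\big((x,t);A\big)=\sum_{m=0}^\infty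 \Gamma^{-1}(A+mI)\,\gamma(A+mI,x)\frac{t^m}{m!},\qquad E\big((x,t);A\big)=\sum_{m=0}^\infty \Gamma^{-1}(A+mI)\,\Gamma(A+mI,x)\frac{t^m}{m!}.$$ *)

theory Defs
  imports "HOL-Analysis.Analysis"
begin

text \<open>
  An \<open>r\<close>-by-\<open>r\<close> complex matrix is an element of \<open>complex ^ 'n ^ 'n\<close> with \<open>r = CARD('n)\<close>.
  The class operations \<open>*\<close>, \<open>^\<close> and \<open>1\<close> on this type act entrywise, so matrix powers, the matrix
  exponential and the Pochhammer symbol are defined below from the matrix product \<open>**\<close> and the
  identity \<open>mat 1\<close>; \<open>mat c\<close> is \<open>c\<close> times the identity.
\<close>

definition mat_cscale :: "complex \<Rightarrow> complex ^ 'n ^ 'm \<Rightarrow> complex ^ 'n ^ 'm" (infixr "*\<^sub>C" 75)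
  where "c *\<^sub>C M = (\<chi> i j. c * M $ i $ j)"

definition mat_eigenvalue :: "complex ^ 'n ^ 'n \<Rightarrow> complex \<Rightarrow> bool"
  where "mat_eigenvalue M l \<longleftrightarrow> (\<exists>v. v \<noteq> 0 \<and> M *v v = l *s v)"

definition positive_stable :: "complex ^ 'n ^ 'n \<Rightarrow> bool"
  where "positive_stable M \<longleftrightarrow> (\<forall>l. mat_eigenvalue M l \<longrightarrow> Re l > 0)"

primrec mat_power :: "complex ^ 'n ^ 'n \<Rightarrow> nat \<Rightarrow> complex ^ 'n ^ 'n" where
  "mat_power M 0 = mat 1"
| "mat_power M (Suc k) = mat_power M k ** M"

definition mat_exp :: "complex ^ 'n ^ 'n \<Rightarrow> complex ^ 'n ^ 'n"
  where "mat_exp M = (\<Sum>k. (1 / fact k) *\<^sub>R mat_power M k)"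

definition mat_powr :: "real \<Rightarrow> complex ^ 'n ^ 'n \<Rightarrow> complex ^ 'n ^ 'n"
  where "mat_powr v M = mat_exp (ln v *\<^sub>R M)"

definition mat_Gamma :: "complex ^ 'n ^ 'n \<Rightarrow> complex ^ 'n ^ 'n"
  where "mat_Gamma M = (LBINT s:{0<..}. exp (- s) *\<^sub>R mat_powr s (M - mat 1))"

definition mat_lower_gamma :: "complex ^ 'n ^ 'n \<Rightarrow> real \<Rightarrow> complex ^ 'n ^ 'n"
  where "mat_lower_gamma M x = (LBINT s:{0<..x}. exp (- s) *\<^sub>R mat_powr s (M - mat 1))"

definition mat_upper_Gamma :: "complex ^ 'n ^ 'n \<Rightarrow> real \<Rightarrow> complex ^ 'n ^ 'n"
  where "mat_upper_Gamma M x = (LBINT s:{x<..}. exp (- s) *\<^sub>R mat_powr s (M - mat 1))"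

primrec mat_pochhammer :: "complex ^ 'n ^ 'n \<Rightarrow> nat \<Rightarrow> complex ^ 'n ^ 'n" where
  "mat_pochhammer M 0 = mat 1"
| "mat_pochhammer M (Suc m) = mat_pochhammer M m ** (M + mat (of_nat m))"

definition mat_0F1 :: "complex ^ 'n ^ 'n \<Rightarrow> complex \<Rightarrow> complex ^ 'n ^ 'n"
  where "mat_0F1 A z = (\<Sum>m. (z ^ m / fact m) *\<^sub>C matrix_inv (mat_pochhammer A m))"

definition inc_exp_lower :: "real \<Rightarrow> complex \<Rightarrow> complex ^ 'n ^ 'n \<Rightarrow> complex ^ 'n ^ 'n"
  where "inc_exp_lower x t A =
    (\<Sum>m. (t ^ m / fact m) *\<^sub>C
         (matrix_inv (mat_Gamma (A + mat (of_nat m))) ** mat_lower_gamma (A + mat (of_nat m)) x))"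

definition inc_exp_upper :: "real \<Rightarrow> complex \<Rightarrow> complex ^ 'n ^ 'n \<Rightarrow> complex ^ 'n ^ 'n"
  where "inc_exp_upper x t A =
    (\<Sum>m. (t ^ m / fact m) *\<^sub>C
         (matrix_inv (mat_Gamma (A + mat (of_nat m))) ** mat_upper_Gamma (A + mat (of_nat m)) x))"

text \<open>
  \<open>has_complex_derivative f D t\<close>: the matrix-valued function \<open>f\<close> of a complex variable is complex
  differentiable at \<open>t\<close> with derivative \<open>D\<close>. The library's \<open>has_field_derivative\<close> covers only
  functions with values in the field itself, and \<open>has_vector_derivative\<close> only a real variable.
\<close>

definition has_complex_derivative ::
    "(complex \<Rightarrow> complex ^ 'n ^ 'n) \<Rightarrow> complex ^ 'n ^ 'n \<Rightarrow> complex \<Rightarrow> bool"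
  where "has_complex_derivative f D t \<longleftrightarrow> (f has_derivative (\<lambda>h. h *\<^sub>C D)) (at t)"

text \<open>
  \<open>has_nth_complex_derivative n f D t\<close>: the \<open>n\<close>-th derivative of \<open>f\<close> exists at \<open>t\<close> and equals \<open>D\<close>.
  As a relation it includes the existence of all derivatives up to order \<open>n\<close>. In the successor case
  \<open>f'\<close> is the derivative of \<open>f\<close> on a neighbourhood of \<open>t\<close>; its values elsewhere are irrelevant.
\<close>

primrec has_nth_complex_derivative ::
    "nat \<Rightarrow> (complex \<Rightarrow> complex ^ 'n ^ 'n) \<Rightarrow> complex ^ 'n ^ 'n \<Rightarrow> complex \<Rightarrow> bool" where
  "has_nth_complex_derivative 0 f D t \<longleftrightarrow> f t = D"
| "has_nth_complex_derivative (Suc n) f D t \<longleftrightarrow>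
     (\<exists>f'. (\<forall>\<^sub>F z in nhds t. has_complex_derivative f (f' z) z) \<and>
           has_nth_complex_derivative n f' D t)"

end

theory Submission
  imports Defs "HOL-Computational_Algebra.Fundamental_Theorem_Algebra" "HOL-Real_Asymp.Real_Asymp"
begin

text \<open>
  Both functions are exponential generating series \<open>\<Sum>m. t^m/m! c\<^sub>m\<close> whose coefficients grow at most
  geometrically, so differentiating in \<open>t\<close> shifts the coefficients, which replaces \<open>A\<close> by \<open>A + I\<close>.
  The growth bound comes from \<open>\<Gamma>(A + mI) = (A)\<^sub>m \<Gamma>(A)\<close>, from \<open>(A + mI)\<^sup>-\<^sup>1 = O(1)\<close> and from
  \<open>\<gamma>(A + mI, x) = O(x^m)\<close>. The coefficients of \<open>E\<close> are \<open>I\<close> minus those of \<open>e\<close>. Differentiating in \<open>x\<close>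
  term by term turns \<open>\<gamma>(A + mI, x)\<close> into \<open>x^m e^(-x) x^(A-I)\<close>, which leaves the series of
  \<open>0F1(-;A;tx)\<close>.

  Convergence of the integrals at \<open>0\<close> needs \<open>\<parallel>exp(-uA)\<parallel> \<le> C e^(-au)\<close> with \<open>a > 0\<close>. It is proved by
  induction over the linear factors of a polynomial annihilating \<open>A\<close>. The matrix \<open>\<Gamma>(A)\<close> is invertible
  because otherwise its kernel, which is invariant under \<open>A\<close>, would contain an eigenvector of \<open>A\<close>, say
  for \<open>l\<close>, and on it \<open>\<Gamma>(A)\<close> acts as the nonzero scalar \<open>\<Gamma>(l)\<close>.
\<close>

section \<open>Complex matrices\<close>

lemma cscale_nth [simp]: "(c *\<^sub>C M) $ i $ j = c * M $ i $ j"
  by (simp add: mat_cscale_def)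

lemma mat_nth: "mat c $ i $ j = (if i = j then c else 0)"
  by (simp add: mat_def)

lemma norm_cscale [simp]: "norm (c *\<^sub>C M) = norm c * norm (M :: complex^'n^'m)"
proof -
  have "norm ((c *\<^sub>C M) $ i) = norm c * norm (M $ i)" for i
    by (simp add: norm_vec_def norm_mult L2_set_right_distrib)
  then show ?thesis
    by (simp add: norm_vec_def[of M] norm_vec_def[of "c *\<^sub>C M"] L2_set_right_distrib)
qed

lemma scaleR_eq_cscale: "r *\<^sub>R M = of_real r *\<^sub>C (M :: complex^'n^'m)"
  by (simp add: vec_eq_iff scaleR_conv_of_real[where 'a=complex])

text \<open>As a bounded bilinear map over the reals, scaling inherits additivity, continuity and a
  product rule for derivatives.\<close>

interpretation cscale: bounded_bilinear "mat_cscale :: complex \<Rightarrow> complex^'n^'m \<Rightarrow> complex^'n^'m"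
proof
  show "\<exists>K. \<forall>a (b :: complex^'n^'m). norm (a *\<^sub>C b) \<le> norm a * norm b * K"
    by (rule exI[of _ 1]) simp
qed (simp_all add: vec_eq_iff algebra_simps scaleR_conv_of_real[where 'a=complex])

lemma cscale_cscale: "a *\<^sub>C b *\<^sub>C M = (a * b) *\<^sub>C (M :: complex^'n^'m)"
  and cscale_one [simp]: "1 *\<^sub>C M = M"
  by (simp_all add: vec_eq_iff algebra_simps)

lemma cscale_mult_left: "(c *\<^sub>C M) ** N = c *\<^sub>C (M ** (N :: complex^'n^'m))"
  and cscale_mult_right: "M ** (c *\<^sub>C N) = c *\<^sub>C (M ** (N :: complex^'n^'m))"
  by (simp_all add: vec_eq_iff matrix_matrix_mult_def sum_distrib_left algebra_simps)

lemma mat_mult_eq_cscale: "mat c ** M = c *\<^sub>C M" "M ** mat c = c *\<^sub>C (M :: complex^'n^'n)"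
  by (simp_all add: vec_eq_iff matrix_matrix_mult_def mat_nth if_distrib if_distribR cong: if_cong)

lemma mat_add: "mat (a + b) = (mat a + mat b :: complex^'n^'n)"
  by (simp add: vec_eq_iff mat_nth)

text \<open>The norm of the type is the Frobenius norm. Each row of the product is a combination of
  the rows of \<open>N\<close>, and Cauchy-Schwarz bounds it by the norm of the corresponding row of
  \<open>M\<close>.\<close>

lemma norm_matrix_mult_le:
  fixes M N :: "complex^'n^'n"
  shows "norm (M ** N) \<le> norm M * norm N"
proof -
  have "norm ((M ** N) $ i) \<le> norm N * norm (M $ i)" for i
  proof -
    have "(M ** N) $ i = (\<Sum>k\<in>UNIV. M $ i $ k *s N $ k)"
      by (simp add: vec_eq_iff matrix_matrix_mult_def)
    moreover have "norm (c *s v) = norm c * norm v" for c and v :: "complex^'n"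
      by (simp add: norm_vec_def norm_mult L2_set_right_distrib)
    ultimately have "norm ((M ** N) $ i) \<le> (\<Sum>k\<in>UNIV. \<bar>norm (M $ i $ k)\<bar> * \<bar>norm (N $ k)\<bar>)"
      using norm_sum[of "\<lambda>k. M $ i $ k *s N $ k" UNIV] by simp
    also have "\<dots> \<le> norm (M $ i) * norm N"
      unfolding norm_vec_def[of "M $ i"] norm_vec_def[of N] by (rule L2_set_mult_ineq)
    finally show ?thesis by (simp add: mult.commute)
  qed
  then have "norm (M ** N) \<le> L2_set (\<lambda>i. norm N * norm (M $ i)) UNIV"
    unfolding norm_vec_def[of "M ** N"] by (intro L2_set_mono) auto
  also have "\<dots> = norm M * norm N"
    by (simp add: norm_vec_def[of M] L2_set_right_distrib mult.commute)
  finally show ?thesis .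
qed

interpretation mmult: bounded_bilinear "(**) :: complex^'n^'n \<Rightarrow> complex^'n^'n \<Rightarrow> complex^'n^'n"
proof
  show "\<exists>K. \<forall>(a :: complex^'n^'n) (b :: complex^'n^'n). norm (a ** b) \<le> norm a * norm b * K"
    by (rule exI[of _ 1]) (simp add: norm_matrix_mult_le)
qed (simp_all add: vec_eq_iff matrix_matrix_mult_def sum.distrib sum_distrib_left algebra_simps
      scaleR_conv_of_real[where 'a=complex])

interpretation mvmult: bounded_bilinear "(*v) :: complex^'n^'n \<Rightarrow> complex^'n \<Rightarrow> complex^'n"
proof -
  have "bilinear ((*v) :: complex^'n^'n \<Rightarrow> complex^'n \<Rightarrow> complex^'n)"
    unfolding bilinear_def
    by (auto intro!: linearI simp: vec_eq_iff matrix_vector_mult_def sum.distrib sum_distrib_left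
        algebra_simps scaleR_conv_of_real[where 'a=complex])
  then show "bounded_bilinear ((*v) :: complex^'n^'n \<Rightarrow> complex^'n \<Rightarrow> complex^'n)"
    by (simp add: bilinear_conv_bounded_bilinear)
qed

section \<open>Matrix inverses\<close>

lemma matrix_inv_left: "invertible M \<Longrightarrow> matrix_inv M ** M = mat 1"
  and matrix_inv_right: "invertible M \<Longrightarrow> M ** matrix_inv M = mat 1"
  for M :: "complex^'n^'n"
  unfolding invertible_def matrix_inv_def by (metis (mono_tags, lifting) someI_ex)+

text \<open>A right inverse of a square matrix is also a left inverse, so a one-sided check
  identifies \<open>matrix_inv\<close>.\<close>

lemma matrix_inv_eq:
  fixes M :: "complex^'n^'n"
  assumes "M ** N = mat 1"
  shows "matrix_inv M = N"
proof -
  have NM: "N ** M = mat 1"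
    using assms by (simp add: matrix_left_right_inverse)
  then have "invertible M" using assms by (auto simp: invertible_def)
  then have "matrix_inv M ** (M ** N) = N"
    by (simp add: matrix_mul_assoc matrix_inv_left)
  then show ?thesis using assms by simp
qed

lemma matrix_inv_mult:
  fixes M N :: "complex^'n^'n"
  assumes "invertible M" "invertible N"
  shows "matrix_inv (M ** N) = matrix_inv N ** matrix_inv M"
proof (rule matrix_inv_eq)
  have "M ** N ** (matrix_inv N ** matrix_inv M) = M ** (N ** matrix_inv N) ** matrix_inv M"
    by (simp only: matrix_mul_assoc)
  then show "M ** N ** (matrix_inv N ** matrix_inv M) = mat 1"
    by (simp add: matrix_inv_right assms)
qed

lemma matrix_inv_commute:
  fixes M N :: "complex^'n^'n"
  assumes "invertible M" "M ** N = N ** M"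
  shows "matrix_inv M ** N = N ** matrix_inv M"
proof -
  have "matrix_inv M ** (M ** N) ** matrix_inv M = matrix_inv M ** (N ** M) ** matrix_inv M"
    by (simp add: assms)
  then have "matrix_inv M ** M ** (N ** matrix_inv M) = matrix_inv M ** N ** (M ** matrix_inv M)"
    by (simp only: matrix_mul_assoc)
  then show ?thesis
    by (simp add: matrix_inv_left matrix_inv_right assms)
qed

section \<open>Exponential series and the matrix exponential\<close>

text \<open>This growth condition suffices for an exponential series to converge at every complex
  argument, and it survives shifts, products and differences.\<close>

definition geom_bounded :: "(nat \<Rightarrow> complex^'n^'n) \<Rightarrow> bool"
  where "geom_bounded c \<longleftrightarrow> (\<exists>C K. \<forall>m. norm (c m) \<le> C * K ^ m)"

text \<open>Both incomplete exponential functions, \<open>mat_0F1\<close> and, for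
  \<open>c = mat_power M\<close>, the exponential \<open>mat_exp (z *\<^sub>C M)\<close> have this
  form, so convergence and differentiation in the argument are settled once for all of them.\<close>

definition exp_series :: "(nat \<Rightarrow> complex^'n^'n) \<Rightarrow> complex \<Rightarrow> complex^'n^'n"
  where "exp_series c t = (\<Sum>m. (t ^ m / fact m) *\<^sub>C c m)"

lemma geom_boundedI: "(\<And>m. norm (c m) \<le> C * K ^ m) \<Longrightarrow> geom_bounded c"
  by (auto simp: geom_bounded_def)

lemma geom_bounded_shift:
  assumes "geom_bounded c" shows "geom_bounded (\<lambda>m. c (m + k))"
proof -
  obtain C K where "\<And>m. norm (c m) \<le> C * K ^ m"
    using assms by (auto simp: geom_bounded_def)
  then have "norm (c (m + k)) \<le> (C * K ^ k) * K ^ m" for m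
    by (metis power_add mult.commute mult.assoc)
  then show ?thesis by (rule geom_boundedI)
qed

text \<open>Comparison with the scalar exponential series at \<open>norm t * K\<close>.\<close>

lemma geom_bounded_summable_norm:
  assumes "geom_bounded c"
  shows "summable (\<lambda>m. norm ((t ^ m / fact m) *\<^sub>C c m))"
proof -
  obtain C K where CK: "\<And>m. norm (c m) \<le> C * K ^ m"
    using assms by (auto simp: geom_bounded_def)
  have "summable (\<lambda>m. C * ((norm t * K) ^ m /\<^sub>R fact m))"
    by (intro summable_mult summable_exp_generic)
  moreover have "norm (norm ((t ^ m / fact m) *\<^sub>C c m)) \<le> C * ((norm t * K) ^ m /\<^sub>R fact m)" for m
  proof -
    have "norm (norm ((t ^ m / fact m) *\<^sub>C c m)) = (norm t ^ m / fact m) * norm (c m)"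
      by (simp add: norm_divide norm_power)
    also have "\<dots> \<le> (norm t ^ m / fact m) * (C * K ^ m)"
      by (intro mult_left_mono CK) auto
    finally show ?thesis by (simp add: field_simps power_mult_distrib)
  qed
  ultimately show ?thesis by (rule summable_comparison_test'[where N=0])
qed

lemma geom_bounded_summable:
  "geom_bounded c \<Longrightarrow> summable (\<lambda>m. (t ^ m / fact m) *\<^sub>C c m)"
  by (rule summable_norm_cancel, rule geom_bounded_summable_norm)

lemma exp_series_sums:
  "geom_bounded c \<Longrightarrow> (\<lambda>m. (t ^ m / fact m) *\<^sub>C c m) sums exp_series c t"
  unfolding exp_series_def by (intro summable_sums geom_bounded_summable)

lemma exp_series_nth_sums:
  assumes "geom_bounded c"
  shows "(\<lambda>m. (c m $ i $ j / fact m) * t ^ m) sums (exp_series c t $ i $ j)"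
proof -
  have "(\<lambda>m. ((t ^ m / fact m) *\<^sub>C c m) $ i $ j) sums (exp_series c t $ i $ j)"
    by (intro sums_vec_nth exp_series_sums assms)
  then show ?thesis by (simp add: mult.commute)
qed

lemma has_derivative_matrixI:
  fixes f :: "'a::real_normed_vector \<Rightarrow> complex^'n^'m"
  assumes "\<And>i j. ((\<lambda>x. f x $ i $ j) has_derivative (\<lambda>h. f' h $ i $ j)) (at x within S)"
  shows "(f has_derivative f') (at x within S)"
  unfolding has_derivative_componentwise_within[of f]
  by (auto simp: Basis_vec_def inner_axis intro!: has_derivative_inner_left assms)

text \<open>Each entry is a scalar power series converging on the whole plane, which may be
  differentiated term by term.\<close>

lemma exp_series_has_complex_derivative:
  assumes "geom_bounded c"
  shows "has_complex_derivative (exp_series c) (exp_series (\<lambda>m. c (Suc m)) t) t"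
  unfolding has_complex_derivative_def
proof (rule has_derivative_matrixI)
  fix i j
  have *: "exp_series c t $ i $ j = (\<Sum>m. (c m $ i $ j / fact m) * t ^ m)" for t
    using exp_series_nth_sums[OF assms] by (rule sums_unique)
  have "((\<lambda>t. exp_series c t $ i $ j) has_field_derivative
      (\<Sum>m. diffs (\<lambda>m. c m $ i $ j / fact m) m * t ^ m)) (at t)"
    unfolding *
    using exp_series_nth_sums[OF assms] by (intro termdiffs_strong_converges_everywhere) (auto simp: sums_iff)
  \<comment> \<open>The factor \<open>Suc m\<close> produced by \<open>diffs\<close> cancels against
    \<open>fact (Suc m)\<close>, which leaves a pure shift of the coefficients.\<close>
  also have "(\<lambda>m. diffs (\<lambda>m. c m $ i $ j / fact m) m * t ^ m)
      = (\<lambda>m. c (Suc m) $ i $ j / fact m * t ^ m)"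
    by (rule ext) (simp add: diffs_def field_simps del: of_nat_Suc)
  also have "(\<Sum>m. c (Suc m) $ i $ j / fact m * t ^ m) = exp_series (\<lambda>m. c (Suc m)) t $ i $ j"
    using exp_series_nth_sums[of "\<lambda>m. c (Suc m)"] geom_bounded_shift[OF assms, of 1]
    by (simp add: sums_iff)
  finally show "((\<lambda>t. exp_series c t $ i $ j) has_derivative
      (\<lambda>h. (h *\<^sub>C exp_series (\<lambda>m. c (Suc m)) t) $ i $ j)) (at t)"
    using mult_commute_abs[of "exp_series (\<lambda>m. c (Suc m)) t $ i $ j"]
    by (simp only: has_field_derivative_def cscale_nth)
qed

text \<open>The derivative is again an exponential series and exists at every point, so the
  neighbourhood condition holds trivially and the induction runs over all coefficient
  sequences.\<close>

lemma exp_series_has_nth_complex_derivative: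
  assumes "geom_bounded c"
  shows "has_nth_complex_derivative n (exp_series c) (exp_series (\<lambda>m. c (m + n)) t) t"
  using assms
proof (induction n arbitrary: c)
  case 0
  then show ?case by simp
next
  case (Suc n)
  have "has_nth_complex_derivative n (exp_series (\<lambda>m. c (Suc m)))
      (exp_series (\<lambda>m. c (m + Suc n)) t) t"
    using Suc.IH[of "\<lambda>m. c (Suc m)"] geom_bounded_shift[OF Suc.prems, of 1] by simp
  then show ?case
    using exp_series_has_complex_derivative[OF Suc.prems] by (auto intro!: exI)
qed

section \<open>Powers and exponential of a matrix\<close>

lemma mat_power_commute:
  assumes "M ** N = N ** M" shows "mat_power M k ** N = N ** mat_power M k"
proof (induction k)
  case (Suc k)
  have "mat_power M k ** M ** N = mat_power M k ** N ** M"
    using assms by (metis matrix_mul_assoc)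
  then show ?case using Suc by (simp add: matrix_mul_assoc)
qed simp

text \<open>The factor \<open>norm (mat 1)\<close> stands for the square root of the dimension, the
  Frobenius norm of the identity.\<close>

lemma norm_mat_power_le: "norm (mat_power M k) \<le> norm (mat 1 :: complex^'n^'n) * norm M ^ k"
  for M :: "complex^'n^'n"
proof (induction k)
  case (Suc k)
  have "norm (mat_power M k ** M) \<le> norm (mat_power M k) * norm M"
    by (rule norm_matrix_mult_le)
  also have "\<dots> \<le> norm (mat 1 :: complex^'n^'n) * norm M ^ k * norm M"
    by (intro mult_right_mono Suc) auto
  finally show ?case by (simp add: mult_ac)
qed simp

lemma geom_bounded_mat_power: "geom_bounded (mat_power M)"
  using norm_mat_power_le by (rule geom_boundedI)

lemma mat_power_cscale: "mat_power (z *\<^sub>C M) k = z ^ k *\<^sub>C mat_power M k"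
  by (induction k) (simp_all add: cscale_mult_left cscale_mult_right cscale_cscale mult.commute)

lemma mat_exp_cscale: "mat_exp (z *\<^sub>C M) = exp_series (mat_power M) z"
  unfolding mat_exp_def exp_series_def mat_power_cscale
  by (simp add: scaleR_eq_cscale cscale_cscale)

lemma mat_exp_eq: "mat_exp M = exp_series (mat_power M) 1"
  using mat_exp_cscale[of 1 M] by simp

lemma mat_exp_sums: "(\<lambda>k. (1 / fact k) *\<^sub>C mat_power M k) sums mat_exp M"
  using exp_series_sums[OF geom_bounded_mat_power, of 1 M] by (simp add: mat_exp_eq)

lemma norm_mat_exp_le: "norm (mat_exp M) \<le> norm (mat 1 :: complex^'n^'n) * exp (norm M)"
  for M :: "complex^'n^'n"
proof -
  have "(\<lambda>k. norm (mat 1 :: complex^'n^'n) * (norm M ^ k /\<^sub>R fact k)) sums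
    (norm (mat 1 :: complex^'n^'n) * exp (norm M))"
    by (intro sums_mult exp_converges)
  moreover have "norm ((1 / fact k) *\<^sub>C mat_power M k) \<le> norm (mat 1 :: complex^'n^'n) * (norm M ^ k /\<^sub>R fact k)" for k
    using norm_mat_power_le[of M k] by (simp add: norm_divide field_simps)
  ultimately show ?thesis
    using mat_exp_sums[of M]
    by (metis (no_types, lifting) norm_suminf_le sums_iff)
qed

lemma mat_exp_commute:
  fixes M N :: "complex^'n^'n"
  assumes "M ** N = N ** M"
  shows "mat_exp M ** N = N ** mat_exp M"
proof -
  have "(\<lambda>k. ((1 / fact k) *\<^sub>C mat_power M k) ** N) sums (mat_exp M ** N)"
    by (rule bounded_linear.sums[OF mmult.bounded_linear_left mat_exp_sums])
  moreover have "(\<lambda>k. N ** ((1 / fact k) *\<^sub>C mat_power M k)) sums (N ** mat_exp M)"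
    by (rule bounded_linear.sums[OF mmult.bounded_linear_right mat_exp_sums])
  ultimately show ?thesis
    by (simp add: cscale_mult_left cscale_mult_right mat_power_commute[OF assms] sums_iff)
qed

text \<open>Every power of \<open>M\<close> acts on \<open>v\<close> as the scalar
  \<open>l ^ k\<close>, so the series applied to \<open>v\<close> is the scalar exponential series,
  entry by entry.\<close>

lemma mat_exp_eigenvector:
  assumes "M *v v = l *s v"
  shows "mat_exp M *v v = exp l *s v"
proof -
  have p: "mat_power M k *v v = l ^ k *s v" for k
  proof (induction k)
    case (Suc k)
    have "mat_power M (Suc k) *v v = l *s (mat_power M k *v v)"
      by (simp only: mat_power.simps matrix_vector_mul_assoc[symmetric] assms vector_scalar_commute)
    then show ?case
      by (simp add: Suc vector_smult_assoc)
  qed simp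
  have "(\<lambda>k. ((1 / fact k) *\<^sub>C mat_power M k) *v v) sums (mat_exp M *v v)"
    by (rule bounded_linear.sums[OF mvmult.bounded_linear_left mat_exp_sums])
  moreover have "((1 / fact k) *\<^sub>C mat_power M k) *v v = (l ^ k /\<^sub>R fact k) *s v" for k
  proof -
    have "((1 / fact k) *\<^sub>C mat_power M k) *v v = (1 / fact k) *s (mat_power M k *v v)"
      by (simp add: vec_eq_iff matrix_vector_mult_def sum_distrib_left mult.assoc)
    then show ?thesis by (simp add: p vector_smult_assoc scaleR_conv_of_real field_simps)
  qed
  ultimately have "(\<lambda>k. (l ^ k /\<^sub>R fact k) *s v) sums (mat_exp M *v v)" by simp
  then have "(\<lambda>k. (l ^ k /\<^sub>R fact k) * v $ i) sums ((mat_exp M *v v) $ i)" for i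
    using sums_vec_nth by fastforce
  moreover have "(\<lambda>k. (l ^ k /\<^sub>R fact k) * v $ i) sums (exp l * v $ i)" for i
    by (intro sums_mult2 exp_converges)
  ultimately show ?thesis
    by (simp add: vec_eq_iff) (metis sums_unique2)
qed

text \<open>The function is the restriction of \<open>exp_series (mat_power M)\<close> to the real
  line, and shifting the coefficients of that series multiplies it by \<open>M\<close>.\<close>

lemma mat_exp_scaleR_has_vector_derivative:
  "((\<lambda>u. mat_exp (u *\<^sub>R M)) has_vector_derivative (M ** mat_exp (u *\<^sub>R M))) (at u within S)"
proof -
  have shift: "exp_series (\<lambda>m. mat_power M (Suc m)) z = M ** exp_series (mat_power M) z" for z
  proof -
    have "(\<lambda>m. M ** ((z ^ m / fact m) *\<^sub>C mat_power M m)) sums (M ** exp_series (mat_power M) z)"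
      by (rule bounded_linear.sums[OF mmult.bounded_linear_right exp_series_sums[OF geom_bounded_mat_power]])
    moreover have "mat_power M (Suc m) = M ** mat_power M m" for m
      using mat_power_commute[of M M m] by simp
    ultimately show ?thesis
      unfolding exp_series_def[of "\<lambda>m. mat_power M (Suc m)"] by (simp add: cscale_mult_right sums_iff)
  qed
  have "(exp_series (mat_power M) has_derivative
      (\<lambda>h. h *\<^sub>C (M ** exp_series (mat_power M) (of_real u)))) (at (of_real u))"
    using exp_series_has_complex_derivative[OF geom_bounded_mat_power, of M "of_real u"]
    by (simp only: has_complex_derivative_def shift)
  then have "((\<lambda>u. exp_series (mat_power M) (of_real u)) has_derivative
      (\<lambda>h. of_real h *\<^sub>C (M ** exp_series (mat_power M) (of_real u)))) (at u within S)"
    by (rule has_derivative_compose[of of_real of_real, rotated])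
      (intro bounded_linear_imp_has_derivative bounded_linear_of_real)
  then show ?thesis
    by (simp add: has_vector_derivative_def scaleR_eq_cscale mat_exp_cscale)
qed

lemma mat_exp_zero [simp]: "mat_exp (0 :: complex^'n^'n) = mat 1"
proof -
  have "mat_power (0 :: complex^'n^'n) k = (if k = 0 then mat 1 else 0)" for k
    by (induction k) simp_all
  then have "(\<lambda>k. (1 / fact k) *\<^sub>C mat_power (0 :: complex^'n^'n) k) = (\<lambda>k. if k = 0 then mat 1 else 0)"
    by (intro ext) (simp add: cscale.zero_right)
  then show ?thesis
    using sums_single[of 0 "\<lambda>_. mat 1 :: complex^'n^'n"] mat_exp_sums[of "0 :: complex^'n^'n"]
    by (simp only: sums_unique2)
qed

text \<open>The function \<open>Y\<close> has derivative zero, because \<open>M\<close> commutes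
  with its exponential and the scalar factor compensates the summand \<open>mat c\<close>. Comparing
  \<open>Y 1\<close> with \<open>Y 0\<close>, which is the identity, gives the claim. The case
  \<open>c = 0\<close> inverts the exponential.\<close>

lemma mat_exp_uminus_mult_add:
  fixes M :: "complex^'n^'n"
  shows "mat_exp (- M) ** mat_exp (M + mat c) = exp c *\<^sub>C mat 1"
proof -
  define Y where "Y u = exp (- of_real u * c) *\<^sub>C (mat_exp (u *\<^sub>R (- M)) ** mat_exp (u *\<^sub>R (M + mat c)))" for u
  have "(Y has_derivative (\<lambda>h. 0)) (at u within UNIV)" for u
  proof -
    let ?P = "mat_exp (u *\<^sub>R (- M))" and ?Q = "mat_exp (u *\<^sub>R (M + mat c))"
    have e: "((\<lambda>u. exp (- of_real u * c)) has_vector_derivative (exp (- of_real u * c) * (- c))) (at u)"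
    proof -
      have "((\<lambda>z. exp (- z * c)) has_field_derivative (exp (- of_real u * c) * (- c))) (at (of_real u))"
        by (auto intro!: derivative_eq_intros)
      then show ?thesis
        by (rule has_vector_derivative_real_field)
    qed
    have "(Y has_vector_derivative (exp (- of_real u * c) *\<^sub>C (?P ** ((M + mat c) ** ?Q) + ((- M) ** ?P) ** ?Q)
       + (exp (- of_real u * c) * (- c)) *\<^sub>C (?P ** ?Q))) (at u)"
      unfolding Y_def
      by (rule cscale.has_vector_derivative[OF e] mmult.has_vector_derivative
        mat_exp_scaleR_has_vector_derivative)+
    moreover have "?P ** M = M ** ?P"
      by (intro mat_exp_commute) (simp add: mmult.scaleR_left mmult.scaleR_right mmult.minus_left mmult.minus_right)
    then have "?P ** (M ** ?Q) = M ** ?P ** ?Q"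
      by (simp add: matrix_mul_assoc)
    then have "exp (- of_real u * c) *\<^sub>C (?P ** ((M + mat c) ** ?Q) + ((- M) ** ?P) ** ?Q)
       + (exp (- of_real u * c) * (- c)) *\<^sub>C (?P ** ?Q) = 0"
      by (simp add: mmult.add_left mmult.add_right mmult.minus_left mat_mult_eq_cscale cscale_mult_right
         cscale_cscale cscale.minus_left)
    ultimately show ?thesis by (simp add: has_vector_derivative_def)
  qed
  then have "Y 1 = Y 0"
    by (intro has_derivative_zero_unique[of UNIV]) auto
  then have "exp c *\<^sub>C Y 1 = exp c *\<^sub>C mat 1"
    by (simp add: Y_def)
  then show ?thesis
    by (simp add: Y_def cscale_cscale flip: exp_add)
qed

lemma mat_exp_add_mat: "mat_exp (M + mat c) = exp c *\<^sub>C mat_exp M"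
proof -
  have "mat_exp M ** mat_exp (- M) = mat 1"
    using mat_exp_uminus_mult_add[of "- M" 0] by simp
  then have "mat_exp (M + mat c) = mat_exp M ** (mat_exp (- M) ** mat_exp (M + mat c))"
    by (simp add: matrix_mul_assoc)
  then show ?thesis
    by (simp add: mat_exp_uminus_mult_add cscale_mult_right)
qed

section \<open>Spectral estimates\<close>

lemma mat_mult_vec: "mat c *v v = c *s (v :: complex^'n)"
  by (simp add: vec_eq_iff matrix_vector_mult_def mat_nth if_distrib if_distribR cong: if_cong)

text \<open>Horner's rule for the value of \<open>p\<close> at the matrix \<open>A\<close>.\<close>

definition mat_poly :: "complex poly \<Rightarrow> complex^'n^'n \<Rightarrow> complex^'n^'n"
  where "mat_poly p A = fold_coeffs (\<lambda>c X. mat c + A ** X) p 0"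

lemma mat_poly_0 [simp]: "mat_poly 0 A = 0"
  by (simp add: mat_poly_def)

lemma mat_0: "mat 0 = (0 :: complex^'n^'n)"
  by (simp add: vec_eq_iff mat_nth)

lemma mat_poly_pCons [simp]: "mat_poly (pCons c p) A = mat c + A ** mat_poly p A"
  by (cases "p = 0 \<and> c = 0") (auto simp: mat_poly_def mat_0)

lemma mat_poly_add: "mat_poly (p + q) A = mat_poly p A + mat_poly q A"
  by (induction p q rule: poly_induct2) (simp_all add: mat_add mmult.add_right)

lemma mat_poly_smult: "mat_poly (smult c p) A = c *\<^sub>C mat_poly p A"
proof (induction p)
  case (pCons b p)
  have "mat (c * b) = c *\<^sub>C (mat b :: complex^'n^'n)"
    by (simp add: vec_eq_iff mat_nth)
  then show ?case using pCons by (simp add: cscale.add_right cscale_mult_right)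
qed (simp add: cscale.zero_right)

lemma mat_poly_diff: "mat_poly (p - q) A = mat_poly p A - mat_poly q A"
  using mat_poly_add[of "p - q" q A] by simp

lemma mat_poly_monom: "mat_poly (monom c k) A = c *\<^sub>C mat_power A k"
proof (induction k)
  case 0
  show ?case by (simp add: monom_0 vec_eq_iff mat_nth)
next
  case (Suc k)
  then show ?case
    by (simp add: monom_Suc mat_0 cscale_mult_right mat_power_commute)
qed

lemma mat_poly_sum: "mat_poly (sum f S) A = (\<Sum>i\<in>S. mat_poly (f i) A)"
  by (induction S rule: infinite_finite_induct) (simp_all add: mat_poly_add)

text \<open>A dimension count takes the place of the Cayley-Hamilton theorem: the powers with
  exponents up to the real dimension of the matrix space are one too many to be independent. If two
  of them coincide, a difference of monomials annihilates \<open>A\<close>.\<close>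

lemma exists_annihilating_poly: "\<exists>p. p \<noteq> 0 \<and> mat_poly p (A :: complex^'n^'n) = 0"
proof (cases "inj_on (mat_power A) {..DIM(complex^'n^'n)}")
  case False
  then obtain i j where ij: "i \<noteq> j" "mat_power A i = mat_power A j"
    by (auto simp: inj_on_def)
  have "coeff (monom 1 i - monom (1::complex) j) i \<noteq> 0"
    using ij by simp
  then have "monom 1 i - monom (1::complex) j \<noteq> 0" by force
  moreover have "mat_poly (monom 1 i - monom 1 j) A = 0"
    by (simp add: mat_poly_diff mat_poly_monom ij)
  ultimately show ?thesis
    by (intro exI[of _ "monom 1 i - monom (1::complex) j"]) simp
next
  case True
  let ?N = "DIM(complex^'n^'n)"
  have "card (mat_power A ` {..?N}) > ?N"
    using True by (simp only: card_image card_atMost)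
  then have "dependent (mat_power A ` {..?N})"
    by (intro dependent_biggerset) auto
  then obtain u where u: "\<exists>v\<in>mat_power A ` {..?N}. u v \<noteq> 0"
    "(\<Sum>v\<in>mat_power A ` {..?N}. u v *\<^sub>R v) = 0"
    by (subst (asm) dependent_finite) auto
  \<comment> \<open>By injectivity, the linear relation over the set of powers is a relation over
    their exponents.\<close>
  define p where "p = (\<Sum>k\<in>{..?N}. monom (complex_of_real (u (mat_power A k))) k)"
  have "mat_poly p A = 0"
    using u(2) True by (simp add: p_def mat_poly_sum mat_poly_monom scaleR_eq_cscale sum.reindex)
  moreover obtain k where "k \<le> ?N" "u (mat_power A k) \<noteq> 0"
    using u(1) by auto
  then have "coeff p k \<noteq> 0"
    by (simp add: p_def coeff_sum)
  ultimately show ?thesis by (intro exI[of _ p]) auto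
qed

section \<open>Products of linear factors and eigenvectors\<close>

definition root_prod :: "complex^'n^'n \<Rightarrow> complex list \<Rightarrow> complex^'n^'n \<Rightarrow> complex^'n^'n"
  where "root_prod A ls B = foldr (\<lambda>l X. (A - mat l) ** X) ls B"

lemma root_prod_simps [simp]:
  "root_prod A [] B = B"
  "root_prod A (l # ls) B = (A - mat l) ** root_prod A ls B"
  by (simp_all add: root_prod_def)

text \<open>The fundamental theorem of algebra splits off one root at a time; the list repeats roots
  according to multiplicity.\<close>

lemma mat_poly_eq_root_prod:
  "p \<noteq> 0 \<Longrightarrow> \<exists>c ls. c \<noteq> 0 \<and> mat_poly p A = c *\<^sub>C root_prod A ls (mat 1)"
proof (induction "degree p" arbitrary: p)
  case 0
  then obtain c where "p = [:c:]" "c \<noteq> 0"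
    by (metis degree_eq_zeroE pCons_0_0)
  then show ?case
    by (intro exI[of _ c] exI[of _ "[]"]) (simp add: vec_eq_iff mat_nth)
next
  case (Suc n)
  then obtain l where "poly p l = 0"
    by (metis fundamental_theorem_of_algebra constant_degree nat.distinct(1))
  then obtain q where q: "p = [:- l, 1:] * q"
    by (auto simp: poly_eq_0_iff_dvd)
  with Suc.prems have "q \<noteq> 0" by auto
  then have "degree p = Suc (degree q)"
    unfolding q by (subst degree_mult_eq) auto
  with Suc.hyps \<open>q \<noteq> 0\<close> obtain c ls where c: "c \<noteq> 0" "mat_poly q A = c *\<^sub>C root_prod A ls (mat 1)"
    by (metis nat.inject)
  have "mat_poly p A = (A - mat l) ** mat_poly q A"
    by (simp add: q mat_poly_diff mat_poly_add mat_poly_smult mat_0 mmult.diff_left mat_mult_eq_cscale cscale.minus_left)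
  then show ?case
    using c by (intro exI[of _ c] exI[of _ "l # ls"]) (simp add: cscale_mult_right)
qed

lemma exists_root_prod_eq_0: "\<exists>ls. root_prod A ls (mat 1) = 0"
proof -
  obtain p where "p \<noteq> 0" "mat_poly p A = 0"
    using exists_annihilating_poly by blast
  then obtain c ls where "c \<noteq> 0" "c *\<^sub>C root_prod A ls (mat 1) = 0"
    using mat_poly_eq_root_prod by metis
  then show ?thesis by (auto simp: vec_eq_iff)
qed

text \<open>The factors commute, being polynomials in \<open>A\<close>. This lets an induction over
  the list absorb its leading factor into the trailing matrix \<open>B\<close>.\<close>

lemma root_prod_mult: "root_prod A ls ((A - mat l) ** B) = (A - mat l) ** root_prod A ls B"
proof (induction ls)
  case (Cons k ls)
  have "(A - mat k) ** (A - mat l) = (A - mat l) ** (A - mat k)"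
    by (simp add: mmult.diff_left mmult.diff_right mat_mult_eq_cscale)
      (simp add: vec_eq_iff mat_nth algebra_simps)
  then show ?case using Cons by (simp add: matrix_mul_assoc)
qed simp

text \<open>Every nonzero vector in the range of \<open>X\<close> is an eigenvector.\<close>

lemma mat_eigenvalueI:
  assumes "(A - mat l) ** X = 0" "X \<noteq> 0"
  shows "mat_eigenvalue A l"
proof -
  obtain w where "X *v w \<noteq> 0"
    using assms(2) matrix_eq[of X 0] by (auto simp: mvmult.zero_left)
  moreover have "(A - mat l) *v (X *v w) = 0"
    using assms(1) by (simp add: matrix_vector_mul_assoc mvmult.zero_left)
  ultimately show ?thesis
    by (auto simp: mat_eigenvalue_def mvmult.diff_left mat_mult_vec)
qed

text \<open>The linear factors of an annihilating polynomial of \<open>A\<close> are applied to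
  \<open>w\<close> one after another. All vectors obtained stay in the kernel of \<open>B\<close>,
  which commutes with \<open>A\<close>, and the last one is zero. So some factor
  \<open>A - mat l\<close> sends a nonzero vector of the kernel to zero.\<close>

lemma exists_eigenvector_in_kernel:
  fixes A B :: "complex^'n^'n"
  assumes "A ** B = B ** A" and w: "w \<noteq> 0" "B *v w = 0"
  shows "\<exists>v l. v \<noteq> 0 \<and> A *v v = l *s v \<and> B *v v = 0"
proof -
  have ker: "B *v (root_prod A ls (mat 1) *v w) = 0" for ls
  proof (induction ls)
    case (Cons l ls)
    have "B ** (A - mat l) = (A - mat l) ** B"
      using assms(1) by (simp add: mmult.diff_left mmult.diff_right mat_mult_eq_cscale)
    then have "B *v (root_prod A (l # ls) (mat 1) *v w) = (A - mat l) *v (B *v (root_prod A ls (mat 1) *v w))"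
      by (simp add: matrix_vector_mul_assoc matrix_mul_assoc)
    then show ?case using Cons by (simp add: mvmult.zero_right)
  qed (simp add: w)
  have "root_prod A ls (mat 1) *v w = 0 \<Longrightarrow> ?thesis" for ls
  proof (induction ls)
    case Nil
    then show ?case using w by simp
  next
    case (Cons l ls)
    let ?y = "root_prod A ls (mat 1) *v w"
    show ?case
    proof (cases "?y = 0")
      case False
      have "(A - mat l) *v ?y = 0"
        using Cons.prems by (simp add: matrix_vector_mul_assoc)
      then have "A *v ?y = l *s ?y"
        by (simp add: mvmult.diff_left mat_mult_vec)
      then show ?thesis using False ker by blast
    qed (rule Cons.IH)
  qed
  moreover obtain ls where "root_prod A ls (mat 1) = 0"
    using exists_root_prod_eq_0 by blast
  ultimately show ?thesis
    using mvmult.zero_left by metis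
qed

text \<open>
  In the induction step, \<open>g u = exp(lu) exp(-uA) B\<close> has derivative \<open>- exp(lu) exp(-uA) (A - lI) B\<close>,
  to which the induction hypothesis applies. Factors whose root \<open>l\<close> is not an eigenvalue can be
  cancelled.
\<close>

lemma mat_exp_decay_root_prod:
  fixes A B :: "complex^'n^'n"
  assumes "root_prod A ls B = 0"
    and "\<And>l. l \<in> set ls \<Longrightarrow> mat_eigenvalue A l \<Longrightarrow> a < Re l"
  shows "\<exists>C\<ge>0. \<forall>u\<ge>0. norm (mat_exp (u *\<^sub>R (- A)) ** B) \<le> C * exp (- a * u)"
  using assms
proof (induction ls arbitrary: B)
  case Nil
  then show ?case by (auto intro!: exI[of _ 0])
next
  case (Cons l ls)
  show ?case
  proof (cases "root_prod A ls B = 0")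
    case True
    then show ?thesis using Cons by auto
  next
    case False
    \<comment> \<open>The nonzero matrix \<open>root_prod A ls B\<close> is annihilated by
      \<open>A - mat l\<close>, so \<open>l\<close> is an eigenvalue.\<close>
    then have l: "a < Re l"
      using Cons.prems by (auto intro: mat_eigenvalueI)
    define W where "W = (A - mat l) ** B"
    have "root_prod A ls W = 0"
      using Cons.prems(1) by (simp add: W_def root_prod_mult)
    then obtain C where C: "C \<ge> 0" "\<And>u. u \<ge> 0 \<Longrightarrow> norm (mat_exp (u *\<^sub>R (- A)) ** W) \<le> C * exp (- a * u)"
      using Cons.IH[of W] Cons.prems(2) by auto
    define f where "f u = mat_exp (u *\<^sub>R (- A)) ** B" for u
    define g where "g u = exp (of_real u * l) *\<^sub>C f u" for u
    \<comment> \<open>The derivative of \<open>g\<close> is bounded by \<open>exp (u * Re l)\<close>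
      times \<open>C * exp (- a * u)\<close>, that is by \<open>C * exp (d * u)\<close>, and
      \<open>\<phi>\<close> is an antiderivative of this bound.\<close>
    define d where "d = Re l - a"
    define \<phi> where "\<phi> u = C / d * exp (d * u)" for u
    have "d > 0" using l by (simp add: d_def)
    have g': "(g has_vector_derivative (- (exp (of_real u * l) *\<^sub>C (mat_exp (u *\<^sub>R (- A)) ** W)))) (at u)" for u
    proof -
      let ?P = "mat_exp (u *\<^sub>R (- A))"
      have e: "((\<lambda>u. exp (of_real u * l)) has_vector_derivative (exp (of_real u * l) * l)) (at u)"
      proof -
        have "((\<lambda>z. exp (z * l)) has_field_derivative (exp (of_real u * l) * l)) (at (of_real u))"
          by (auto intro!: derivative_eq_intros)
        then show ?thesis by (rule has_vector_derivative_real_field)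
      qed
      have f: "(f has_vector_derivative ((- A) ** ?P ** B)) (at u)"
        unfolding f_def
        by (rule bounded_linear.has_vector_derivative[OF mmult.bounded_linear_left])
          (rule mat_exp_scaleR_has_vector_derivative)
      have "(g has_vector_derivative (exp (of_real u * l) *\<^sub>C ((- A) ** ?P ** B) + (exp (of_real u * l) * l) *\<^sub>C f u)) (at u)"
        unfolding g_def by (rule cscale.has_vector_derivative[OF e f])
      moreover have "?P ** A = A ** ?P"
        by (intro mat_exp_commute) (simp add: mmult.scaleR_left mmult.scaleR_right mmult.minus_left mmult.minus_right)
      then have "?P ** W = A ** ?P ** B - l *\<^sub>C (?P ** B)"
        by (simp add: W_def mmult.diff_left mmult.diff_right mat_mult_eq_cscale cscale_mult_right matrix_mul_assoc)
      ultimately show ?thesis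
        by (simp add: f_def cscale.diff_right cscale.minus_right mmult.minus_left cscale_cscale)
    qed
    have \<phi>': "(\<phi> has_vector_derivative (C * exp (d * u))) (at u)" for u
      unfolding \<phi>_def has_real_derivative_iff_has_vector_derivative[symmetric]
      using \<open>d > 0\<close> by (auto intro!: derivative_eq_intros)
    have bound: "norm (f u) \<le> (norm B + C / d) * exp (- a * u)" if "u \<ge> 0" for u
    proof -
      have "norm (g u - g 0) \<le> \<phi> u - \<phi> 0"
      proof (cases "u = 0")
        case False
        with that have "u > 0" by simp
        then show ?thesis
        proof (rule differentiable_bound_general)
          show "continuous_on {0..u} g" "continuous_on {0..u} \<phi>"
            using g' \<phi>' by (meson continuous_at_imp_continuous_on has_vector_derivative_continuous)+
          show "(g has_vector_derivative (- (exp (of_real x * l) *\<^sub>C (mat_exp (x *\<^sub>R (- A)) ** W)))) (at x)" for x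
            by (rule g')
          show "(\<phi> has_vector_derivative (C * exp (d * x))) (at x)" for x
            by (rule \<phi>')
          show "norm (- (exp (of_real x * l) *\<^sub>C (mat_exp (x *\<^sub>R (- A)) ** W))) \<le> C * exp (d * x)"
            if "0 < x" for x
          proof -
            have "norm (- (exp (of_real x * l) *\<^sub>C (mat_exp (x *\<^sub>R (- A)) ** W)))
              \<le> exp (x * Re l) * (C * exp (- a * x))"
              unfolding norm_minus_cancel norm_cscale using C(2)[of x] that by (intro mult_mono) auto
            also have "\<dots> = C * exp (d * x)"
              by (simp add: d_def algebra_simps flip: exp_add)
            finally show ?thesis .
          qed
        qed
      qed simp
      moreover have "g 0 = B" by (simp add: g_def f_def)
      moreover have "\<phi> 0 \<ge> 0" using C \<open>d > 0\<close> by (simp add: \<phi>_def)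
      ultimately have "norm (g u) \<le> norm B + \<phi> u"
        using norm_triangle_ineq2[of "g u" B] by simp
      moreover have "norm (g u) = exp (u * Re l) * norm (f u)"
        by (simp add: g_def)
      ultimately have "exp (- u * Re l) * (exp (u * Re l) * norm (f u)) \<le> exp (- u * Re l) * (norm B + \<phi> u)"
        by (intro mult_left_mono) auto
      then have "norm (f u) \<le> exp (- u * Re l) * (norm B + \<phi> u)"
        by (simp add: mult.assoc[symmetric] flip: exp_add)
      also have "\<dots> = exp (- u * Re l) * norm B + C / d * exp (- a * u)"
        by (simp add: \<phi>_def d_def algebra_simps flip: exp_add)
      also have "exp (- u * Re l) * norm B \<le> exp (- a * u) * norm B"
        using l that by (intro mult_right_mono) (auto simp: mult.commute[of u] mult_right_mono)
      finally show ?thesis by (simp add: algebra_simps)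
    qed
    show ?thesis
      using bound C \<open>d > 0\<close> by (intro exI[of _ "norm B + C / d"]) (auto simp: f_def)
  qed
qed

lemma positive_stable_exp_decay:
  fixes A :: "complex^'n^'n"
  assumes "positive_stable A"
  shows "\<exists>a>0. \<exists>C\<ge>0. \<forall>u\<ge>0. norm (mat_exp (u *\<^sub>R (- A))) \<le> C * exp (- a * u)"
proof -
  obtain ls where ls: "root_prod A ls (mat 1) = 0"
    using exists_root_prod_eq_0 by blast
  \<comment> \<open>The element 1 keeps the set nonempty. Roots with nonpositive real part are no
    eigenvalues of \<open>A\<close> and are dropped; halving the minimum makes
    \<open>a < Re l\<close> strict.\<close>
  let ?R = "insert 1 (Re ` {l \<in> set ls. Re l > 0})"
  define a where "a = Min ?R / 2"
  have "Min ?R > 0" by (subst Min_gr_iff) auto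
  then have "a > 0" by (simp add: a_def)
  moreover have "a < Re l" if "l \<in> set ls" "mat_eigenvalue A l" for l
  proof -
    have "Re l > 0" using assms that by (simp add: positive_stable_def)
    then have "Min ?R \<le> Re l" using that by (intro Min_le) auto
    then show ?thesis using \<open>Min ?R > 0\<close> unfolding a_def by linarith
  qed
  ultimately show ?thesis
    using mat_exp_decay_root_prod[OF ls, of a] by auto
qed

section \<open>The matrix Gamma function\<close>

lemma positive_stable_add:
  assumes "positive_stable A" "Re c \<ge> 0"
  shows "positive_stable (A + mat c)"
  unfolding positive_stable_def
proof (intro allI impI)
  fix l assume "mat_eigenvalue (A + mat c) l"
  then obtain v where v: "v \<noteq> 0" "(A + mat c) *v v = l *s v"
    by (auto simp: mat_eigenvalue_def)
  then have "A *v v = (l - c) *s v"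
    by (simp add: mvmult.add_left mat_mult_vec algebra_simps)
  then have "mat_eigenvalue A (l - c)"
    using v by (auto simp: mat_eigenvalue_def)
  then show "Re l > 0" using assms by (fastforce simp: positive_stable_def)
qed

section \<open>Real powers with a matrix exponent\<close>

lemma mat_powr_add_mat_of_nat:
  assumes "s > 0"
  shows "mat_powr s (M + mat (of_nat m)) = s ^ m *\<^sub>R mat_powr s M"
proof -
  have "ln s *\<^sub>R (M + mat (of_nat m)) = ln s *\<^sub>R M + mat (of_real (ln s) * of_nat m)"
    by (simp add: vec_eq_iff mat_nth scaleR_conv_of_real[where 'a=complex] algebra_simps)
  moreover have "exp (of_real (ln s) * of_nat m) = (of_real (s ^ m) :: complex)"
    using assms by (simp add: exp_of_real exp_of_nat2_mult)
  ultimately show ?thesis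
    by (simp add: mat_powr_def mat_exp_add_mat scaleR_eq_cscale)
qed

lemma mat_powr_eq_scaleR:
  assumes "s > 0"
  shows "mat_powr s M = s *\<^sub>R mat_powr s (M - mat 1)"
  using mat_powr_add_mat_of_nat[OF assms, of "M - mat 1" 1] by simp

lemma mat_powr_has_vector_derivative:
  assumes "s > 0"
  shows "((\<lambda>s. mat_powr s M) has_vector_derivative M ** mat_powr s (M - mat 1)) (at s)"
proof -
  have "(ln has_vector_derivative (1 / s)) (at s)"
    using assms by (auto intro!: derivative_eq_intros simp flip: has_real_derivative_iff_has_vector_derivative)
  then have "(((\<lambda>u. mat_exp (u *\<^sub>R M)) \<circ> ln) has_vector_derivative (1 / s) *\<^sub>R (M ** mat_exp (ln s *\<^sub>R M))) (at s)"
    by (rule vector_diff_chain_at) (rule mat_exp_scaleR_has_vector_derivative)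
  moreover have "mat_exp (ln s *\<^sub>R M) = s *\<^sub>R mat_powr s (M - mat 1)"
    using mat_powr_eq_scaleR[OF assms, of M] by (simp add: mat_powr_def)
  ultimately show ?thesis
    using assms by (simp add: mat_powr_def o_def mmult.scaleR_right)
qed

lemma mat_powr_commute:
  fixes M N :: "complex^'n^'n"
  shows "M ** N = N ** M \<Longrightarrow> mat_powr s M ** N = N ** mat_powr s M"
  unfolding mat_powr_def by (intro mat_exp_commute) (simp add: mmult.scaleR_left mmult.scaleR_right)

text \<open>For \<open>s \<le> 1\<close> the exponential decay at \<open>u = - ln s\<close> gives
  the power \<open>s powr a\<close>; for larger \<open>s\<close> the crude bound on the exponential
  gives \<open>s powr norm A\<close>. The sum of two scalar powers covers both ranges, and both
  exponents are positive, as the Gamma integral requires.\<close>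

lemma norm_mat_powr_le:
  fixes A :: "complex^'n^'n"
  assumes "positive_stable A"
  shows "\<exists>a>0. \<exists>b>0. \<exists>C\<ge>0. \<forall>s>0. norm (mat_powr s A) \<le> C * (s powr a + s powr b)"
proof -
  obtain a C where a: "a > 0" "C \<ge> 0"
    "\<And>u. u \<ge> 0 \<Longrightarrow> norm (mat_exp (u *\<^sub>R (- A))) \<le> C * exp (- a * u)"
    using positive_stable_exp_decay[OF assms] by auto
  define N where "N = norm (mat 1 :: complex^'n^'n)"
  \<comment> \<open>The summand 1 makes \<open>b\<close> evidently positive.\<close>
  define b where "b = norm A + 1"
  have "N \<ge> 0" by (simp add: N_def)
  have "b > 0" by (simp add: b_def add_nonneg_pos)
  have "norm (mat_powr s A) \<le> (C + N) * (s powr a + s powr b)" if "s > 0" for s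
  proof (cases "s \<le> 1")
    case True
    then have "norm (mat_powr s A) \<le> C * exp (- a * (- ln s))"
      using a(3)[of "- ln s"] that by (simp add: mat_powr_def)
    also have "\<dots> = C * s powr a"
      using that by (simp add: powr_def)
    also have "\<dots> \<le> (C + N) * (s powr a + s powr b)"
      using a \<open>N \<ge> 0\<close> by (intro mult_mono) auto
    finally show ?thesis .
  next
    case False
    then have "norm (mat_powr s A) \<le> N * exp (ln s * norm A)"
      using norm_mat_exp_le[of "ln s *\<^sub>R A"] by (simp add: mat_powr_def N_def)
    also have "\<dots> \<le> N * s powr b"
      using False \<open>N \<ge> 0\<close> by (intro mult_left_mono) (auto simp: powr_def b_def algebra_simps)
    also have "\<dots> \<le> (C + N) * (s powr a + s powr b)"
      using a \<open>N \<ge> 0\<close> by (intro mult_mono) auto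
    finally show ?thesis .
  qed
  then show ?thesis using a \<open>b > 0\<close> \<open>N \<ge> 0\<close>
    by (intro exI[of _ a] exI[of _ b] exI[of _ "C + N"] conjI) auto
qed

section \<open>The common integrand of the Gamma integrals\<close>

definition gamma_kernel :: "complex^'n^'n \<Rightarrow> real \<Rightarrow> complex^'n^'n"
  where "gamma_kernel A s = exp (- s) *\<^sub>R mat_powr s (A - mat 1)"

lemma gamma_kernel_add_of_nat:
  assumes "s > 0"
  shows "gamma_kernel (A + mat (of_nat m)) s = s ^ m *\<^sub>R gamma_kernel A s"
proof -
  have "A + mat (of_nat m) - mat 1 = A - mat 1 + mat (of_nat m)" by simp
  then show ?thesis
    unfolding gamma_kernel_def by (simp only: mat_powr_add_mat_of_nat[OF assms]) (simp add: mult.commute)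
qed

lemma gamma_kernel_isCont: "s > 0 \<Longrightarrow> isCont (gamma_kernel A) s"
  unfolding gamma_kernel_def
  by (intro continuous_intros)
    (rule has_vector_derivative_continuous[OF mat_powr_has_vector_derivative])

text \<open>The known Gamma integral is a gauge integral. Nonnegativity makes it absolute, and Borel
  measurability carries it from the completed measure to \<open>lborel\<close>.\<close>

lemma set_integrable_Gamma_integrand:
  fixes a :: real
  assumes "a > 0"
  shows "set_integrable lborel {0<..} (\<lambda>s. s powr (a - 1) * exp (- s))"
proof -
  have "(\<lambda>s. s powr (a - 1) / exp s) absolutely_integrable_on {0..}"
    using Gamma_integral_real[OF assms]
    by (intro nonnegative_absolutely_integrable_1) (auto simp: has_integral_iff)
  then have "(\<lambda>s. s powr (a - 1) / exp s) absolutely_integrable_on {0<..}"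
    by (rule set_integrable_subset) auto
  then have "(\<lambda>s. s powr (a - 1) * exp (- s)) absolutely_integrable_on {0<..}"
    by (simp add: exp_minus divide_inverse)
  moreover have "(\<lambda>s. indicator {0<..} s *\<^sub>R (s powr (a - 1) * exp (- s))) \<in> borel_measurable lborel"
    by measurable
  ultimately show ?thesis
    by (simp add: set_integrable_def integrable_completion)
qed

text \<open>The matrix \<open>A - mat 1\<close> need not be positive stable, so the power bound is
  taken for \<open>A\<close> and divided by \<open>s\<close>. The resulting majorant is a
  combination of scalar Gamma integrands with parameters \<open>a\<close> and
  \<open>b\<close>.\<close>

lemma set_integrable_gamma_kernel:
  fixes A :: "complex^'n^'n"
  assumes "positive_stable A"
  shows "set_integrable lborel {0<..} (gamma_kernel A)"
proof -
  obtain a b C where ab: "a > 0" "b > 0" "C \<ge> 0"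
    "\<And>s. s > 0 \<Longrightarrow> norm (mat_powr s A) \<le> C * (s powr a + s powr b)"
    using norm_mat_powr_le[OF assms] by auto
  let ?g = "\<lambda>s. C * (s powr (a - 1) * exp (- s) + s powr (b - 1) * exp (- s))"
  have "set_integrable lborel {0<..} ?g"
    by (intro set_integrable_mult_right set_integral_add set_integrable_Gamma_integrand ab)
  moreover have "set_borel_measurable lborel {0<..} (gamma_kernel A)"
    using borel_measurable_continuous_on_indicator[of "{0<..}" "gamma_kernel A"]
    by (auto simp: set_borel_measurable_def intro!: continuous_at_imp_continuous_on gamma_kernel_isCont)
  moreover have "AE s in lborel. s \<in> {0<..} \<longrightarrow> norm (gamma_kernel A s) \<le> norm (?g s)"
  proof (rule AE_I2, rule impI)
    fix s :: real assume "s \<in> {0<..}"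
    then have that: "s > 0" by simp
    have "s * norm (mat_powr s (A - mat 1)) \<le> C * (s powr a + s powr b)"
      using ab(4)[OF that] that by (simp add: mat_powr_eq_scaleR[OF that, of A])
    also have "\<dots> = s * (C * (s powr (a - 1) + s powr (b - 1)))"
      using that by (simp add: powr_diff field_simps)
    finally have "norm (mat_powr s (A - mat 1)) \<le> C * (s powr (a - 1) + s powr (b - 1))"
      using that by simp
    then have "exp (- s) * norm (mat_powr s (A - mat 1)) \<le> exp (- s) * (C * (s powr (a - 1) + s powr (b - 1)))"
      by (intro mult_left_mono) auto
    also have "\<dots> = ?g s" by (simp add: algebra_simps)
    finally have "norm (gamma_kernel A s) \<le> ?g s" by (simp add: gamma_kernel_def)
    then show "norm (gamma_kernel A s) \<le> norm (?g s)" unfolding real_norm_def by linarith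
  qed
  ultimately show ?thesis
    by (rule set_integrable_bound)
qed

lemma set_integral_bounded_linear:
  fixes f :: "'a \<Rightarrow> 'b::{banach, second_countable_topology}"
    and T :: "'b \<Rightarrow> 'c::{banach, second_countable_topology}"
  assumes "bounded_linear T" "set_integrable M S f"
  shows "set_integrable M S (\<lambda>x. T (f x))"
    and "T (LINT x:S|M. f x) = (LINT x:S|M. T (f x))"
proof -
  have *: "T (indicator S x *\<^sub>R f x) = indicator S x *\<^sub>R T (f x)" for x
    using assms(1) by (simp add: linear_simps)
  show "set_integrable M S (\<lambda>x. T (f x))"
    using integrable_bounded_linear[OF assms(1) assms(2)[unfolded set_integrable_def]]
    by (simp add: set_integrable_def *)
  show "T (LINT x:S|M. f x) = (LINT x:S|M. T (f x))"
    using integral_bounded_linear[OF assms(1) assms(2)[unfolded set_integrable_def]]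
    by (simp add: set_lebesgue_integral_def *)
qed

lemma mat_Gamma_eq: "mat_Gamma A = (LBINT s:{0<..}. gamma_kernel A s)"
  and mat_lower_gamma_eq: "mat_lower_gamma A x = (LBINT s:{0<..x}. gamma_kernel A s)"
  and mat_upper_Gamma_eq: "mat_upper_Gamma A x = (LBINT s:{x<..}. gamma_kernel A s)"
  by (simp_all add: mat_Gamma_def mat_lower_gamma_def mat_upper_Gamma_def gamma_kernel_def)

lemma gamma_kernel_commute:
  fixes A N :: "complex^'n^'n"
  assumes "A ** N = N ** A"
  shows "gamma_kernel A s ** N = N ** gamma_kernel A s"
proof -
  have "mat_powr s (A - mat 1) ** N = N ** mat_powr s (A - mat 1)"
    using assms by (intro mat_powr_commute) (simp add: mmult.diff_left mmult.diff_right)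
  then show ?thesis
    by (simp add: gamma_kernel_def mmult.scaleR_left mmult.scaleR_right)
qed

section \<open>Invertibility and functional equation of the Gamma matrix\<close>

lemma mat_Gamma_commute:
  fixes A N :: "complex^'n^'n"
  assumes "positive_stable A" "A ** N = N ** A"
  shows "mat_Gamma A ** N = N ** mat_Gamma A"
  using set_integral_bounded_linear(2)[OF mmult.bounded_linear_left set_integrable_gamma_kernel[OF assms(1)], of N]
    set_integral_bounded_linear(2)[OF mmult.bounded_linear_right set_integrable_gamma_kernel[OF assms(1)], of N]
    gamma_kernel_commute[OF assms(2)]
  by (simp add: mat_Gamma_eq)

text \<open>At every \<open>s > 0\<close> the kernel acts on \<open>v\<close> as the integrand of
  the scalar Gamma integral at \<open>l\<close>, which converges since
  \<open>Re l > 0\<close>.\<close>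

lemma mat_Gamma_eigenvector:
  fixes A :: "complex^'n^'n"
  assumes "positive_stable A" "A *v v = l *s v" "Re l > 0"
  shows "mat_Gamma A *v v = Gamma l *s v"
proof -
  have k: "gamma_kernel A s *v v = (of_real s powr (l - 1) / of_real (exp s)) *s v" if "s > 0" for s
  proof -
    have "(ln s *\<^sub>R (A - mat 1)) *v v = (of_real (ln s) * (l - 1)) *s v"
      by (simp add: mvmult.scaleR_left mvmult.diff_left assms(2))
        (simp add: vec_eq_iff scaleR_conv_of_real[where 'a=complex] algebra_simps)
    then have "mat_powr s (A - mat 1) *v v = exp (of_real (ln s) * (l - 1)) *s v"
      unfolding mat_powr_def by (rule mat_exp_eigenvector)
    also have "exp (of_real (ln s) * (l - 1)) = of_real s powr (l - 1)"
      using that by (simp add: powr_def Ln_of_real mult.commute)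
    finally show ?thesis
      by (simp add: gamma_kernel_def mvmult.scaleR_left)
        (simp add: vec_eq_iff scaleR_conv_of_real[where 'a=complex] exp_minus divide_inverse exp_of_real)
  qed
  have "(mat_Gamma A *v v) $ i = (Gamma l *s v) $ i" for i
  proof -
    have bl: "bounded_linear (\<lambda>X :: complex^'n^'n. (X *v v) $ i)"
      by (rule bounded_linear_compose[OF bounded_linear_vec_nth mvmult.bounded_linear_left])
    note I = set_integral_bounded_linear[OF bl set_integrable_gamma_kernel[OF assms(1)]]
    have "(mat_Gamma A *v v) $ i = integral {0<..} (\<lambda>s. (gamma_kernel A s *v v) $ i)"
      unfolding mat_Gamma_eq I(2) by (rule set_borel_integral_eq_integral(2)[OF I(1)])
    also have "\<dots> = integral {0<..} (\<lambda>s. (of_real s powr (l - 1) / of_real (exp s)) * v $ i)"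
      by (intro integral_cong) (simp add: k)
    also have "\<dots> = Gamma l * v $ i"
      by (intro integral_unique has_integral_mult_left Gamma_integral_complex' assms)
    finally show ?thesis by simp
  qed
  then show ?thesis by (simp add: vec_eq_iff)
qed

lemma invertible_mat_Gamma:
  fixes A :: "complex^'n^'n"
  assumes "positive_stable A"
  shows "invertible (mat_Gamma A)"
proof (rule ccontr)
  assume "\<not> invertible (mat_Gamma A)"
  then obtain w where "w \<noteq> 0" "mat_Gamma A *v w = 0"
    by (auto simp: invertible_left_inverse matrix_left_invertible_ker)
  moreover have "A ** mat_Gamma A = mat_Gamma A ** A"
    using mat_Gamma_commute[OF assms] by simp
  ultimately obtain v l where v: "v \<noteq> 0" "A *v v = l *s v" "mat_Gamma A *v v = 0"
    using exists_eigenvector_in_kernel by metis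
  then have l: "Re l > 0"
    using assms by (auto simp: positive_stable_def mat_eigenvalue_def)
  then have "Gamma l *s v = 0"
    using mat_Gamma_eigenvector[OF assms v(2)] v(3) by simp
  then have "Gamma l = 0" using v(1) by (auto simp: vec_eq_iff)
  \<comment> \<open>By convention \<open>Gamma\<close> is 0 at its poles, the nonpositive integers,
    and it vanishes nowhere else.\<close>
  then show False using l by (auto simp: Gamma_eq_zero_iff elim!: nonpos_Ints_cases)
qed

text \<open>Integration by parts, carried out as the fundamental theorem of calculus on the
  half-line. The primitive \<open>F\<close> tends to 0 at both ends: at 0 because the exponents
  \<open>a\<close> and \<open>b\<close> are positive, at infinity because of
  \<open>exp (- s)\<close>.\<close>

lemma mat_Gamma_add_1:
  fixes A :: "complex^'n^'n"
  assumes "positive_stable A"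
  shows "mat_Gamma (A + mat 1) = A ** mat_Gamma A"
proof -
  define F where "F s = exp (- s) *\<^sub>R mat_powr s A" for s
  define f where "f s = A ** gamma_kernel A s - gamma_kernel (A + mat 1) s" for s
  have "positive_stable (A + mat 1)" using assms by (simp add: positive_stable_add)
  note int = set_integrable_gamma_kernel[OF assms] set_integrable_gamma_kernel[OF this]
  note intA = set_integral_bounded_linear[OF mmult.bounded_linear_right int(1), of A]
  have F': "(F has_vector_derivative f s) (at s)" if "s > 0" for s
  proof -
    have "((\<lambda>s. exp (- s)) has_real_derivative - exp (- s)) (at s)"
      by (auto intro!: derivative_eq_intros)
    from has_vector_derivative_scaleR[OF this mat_powr_has_vector_derivative[OF that, of A]]
    show ?thesis
      by (simp add: F_def[abs_def] f_def gamma_kernel_def mmult.scaleR_right)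
  qed
  have lim: "(F \<longlongrightarrow> 0) (at_right 0)" "(F \<longlongrightarrow> 0) at_top"
  proof -
    obtain a b C where ab: "a > 0" "b > 0" "C \<ge> 0"
      "\<And>s. s > 0 \<Longrightarrow> norm (mat_powr s A) \<le> C * (s powr a + s powr b)"
      using norm_mat_powr_le[OF assms] by auto
    let ?g = "\<lambda>s. exp (- s) * (C * (s powr a + s powr b))"
    have le: "norm (F s) \<le> ?g s" if "s > 0" for s
      using ab(4)[OF that] by (simp add: F_def)
    have "((\<lambda>s. exp (- s) * s powr c) \<longlongrightarrow> 0) (at_right 0)"
      "((\<lambda>s. exp (- s) * s powr c) \<longlongrightarrow> 0) at_top" if "c > 0" for c :: real
      using that by real_asymp+
    note lims = tendsto_mult_right_zero[OF tendsto_add_zero[OF this(1) this(1)], of a b C]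
      tendsto_mult_right_zero[OF tendsto_add_zero[OF this(2) this(2)], of a b C]
    have "(?g \<longlongrightarrow> 0) (at_right 0)"
      using lims(1) ab by (simp add: algebra_simps)
    then show "(F \<longlongrightarrow> 0) (at_right 0)"
      by (rule Lim_null_comparison[rotated]) (use le in \<open>auto simp: eventually_at_right_less intro: eventually_mono[OF eventually_at_right_less]\<close>)
    have "(?g \<longlongrightarrow> 0) at_top"
      using lims(2) ab by (simp add: algebra_simps)
    then show "(F \<longlongrightarrow> 0) at_top"
      by (rule Lim_null_comparison[rotated]) (use le in \<open>auto intro: eventually_mono[OF eventually_gt_at_top[of 0]]\<close>)
  qed
  have fint: "set_integrable lborel {0<..} f"
    unfolding f_def by (intro set_integral_diff intA int)
  have "(LBINT s=ereal 0..\<infinity>. f s) = 0 - 0"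
  proof (rule interval_integral_FTC_integrable[where F = F])
    show "isCont f s" if "ereal 0 < ereal s" for s
      unfolding f_def using that
      by (intro continuous_intros mmult.continuous gamma_kernel_isCont) auto
    show "((F \<circ> real_of_ereal) \<longlongrightarrow> 0) (at_right (ereal 0))" "((F \<circ> real_of_ereal) \<longlongrightarrow> 0) (at_left \<infinity>)"
      unfolding ereal_tendsto_simps1 by (fact lim)+
  qed (use F' fint in auto)
  then have "(LBINT s:{0<..}. f s) = 0"
    by (simp add: interval_lebesgue_integral_def)
  then have "A ** mat_Gamma A - mat_Gamma (A + mat 1) = 0"
    unfolding f_def mat_Gamma_eq intA(2) set_integral_diff(2)[OF intA(1) int(2)] .
  then show ?thesis by simp
qed

section \<open>Pochhammer symbols and bounds for their inverses\<close>

lemma mat_pochhammer_commute: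
  fixes A N :: "complex^'n^'n"
  assumes "A ** N = N ** A"
  shows "mat_pochhammer A m ** N = N ** mat_pochhammer A m"
proof (induction m)
  case (Suc m)
  have "mat_pochhammer A (Suc m) ** N = mat_pochhammer A m ** ((A + mat (of_nat m)) ** N)"
    by (simp add: matrix_mul_assoc)
  also have "(A + mat (of_nat m)) ** N = N ** (A + mat (of_nat m))"
    using assms by (simp add: mmult.add_left mmult.add_right mat_mult_eq_cscale)
  finally show ?case using Suc by (simp add: matrix_mul_assoc)
qed simp

lemma mat_Gamma_add_of_nat:
  fixes A :: "complex^'n^'n"
  assumes "positive_stable A"
  shows "mat_Gamma (A + mat (of_nat m)) = mat_pochhammer A m ** mat_Gamma A"
proof (induction m)
  case 0
  then show ?case by (simp add: mat_0)
next
  case (Suc m)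
  have "A + mat (of_nat (Suc m)) = A + mat (of_nat m) + mat 1"
    by (simp add: mat_add)
  moreover have "positive_stable (A + mat (of_nat m))"
    using assms by (simp add: positive_stable_add)
  ultimately have "mat_Gamma (A + mat (of_nat (Suc m))) = (A + mat (of_nat m)) ** mat_Gamma (A + mat (of_nat m))"
    by (simp only: mat_Gamma_add_1)
  also have "\<dots> = (A + mat (of_nat m)) ** mat_pochhammer A m ** mat_Gamma A"
    by (simp add: Suc matrix_mul_assoc)
  \<comment> \<open>The functional equation puts the new factor on the left, the recursion of
    \<open>mat_pochhammer\<close> on the right.\<close>
  also have "(A + mat (of_nat m)) ** mat_pochhammer A m = mat_pochhammer A m ** (A + mat (of_nat m))"
    by (subst mat_pochhammer_commute) (simp_all add: mmult.add_left mmult.add_right mat_mult_eq_cscale)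
  finally show ?case by simp
qed

lemma invertible_mat_pochhammer:
  "(\<And>k::nat. invertible (A + mat (of_nat k))) \<Longrightarrow> invertible (mat_pochhammer A m)"
  for A :: "complex^'n^'n"
  by (induction m) (auto intro: invertible_mult simp: invertible_def[of "mat 1"] intro!: exI[of _ "mat 1"])

text \<open>Solving \<open>(A + k I) X = I\<close> for \<open>k X\<close> bounds
  \<open>norm X\<close> by the norm of the identity as soon as \<open>k\<close> is at least
  \<open>norm A + 1\<close>. The finitely many smaller \<open>k\<close> are covered by the sum of
  their norms.\<close>

lemma bounded_matrix_inv_add_of_nat:
  fixes A :: "complex^'n^'n"
  assumes "\<And>k::nat. invertible (A + mat (of_nat k))"
  shows "\<exists>K\<ge>0. \<forall>k::nat. norm (matrix_inv (A + mat (of_nat k))) \<le> K"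
proof -
  obtain N :: nat where N: "norm A + 1 \<le> real N"
    using real_arch_simple by blast
  let ?X = "\<lambda>k::nat. matrix_inv (A + mat (of_nat k))"
  let ?K = "norm (mat 1 :: complex^'n^'n) + (\<Sum>k<N. norm (?X k))"
  have "norm (?X k) \<le> ?K" for k
  proof (cases "k < N")
    case True
    then have "norm (?X k) \<le> (\<Sum>k<N. norm (?X k))"
      by (intro member_le_sum) auto
    then show ?thesis by (simp add: add_increasing)
  next
    case False
    have "A ** ?X k + of_nat k *\<^sub>C ?X k = mat 1"
      using matrix_inv_right[OF assms, of k] by (simp add: mmult.add_left mat_mult_eq_cscale)
    then have "of_nat k *\<^sub>C ?X k = mat 1 - A ** ?X k"
      by (simp add: algebra_simps)
    then have "real k * norm (?X k) = norm (mat 1 - A ** ?X k)"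
      by (metis norm_cscale norm_of_nat)
    also have "\<dots> \<le> norm (mat 1 :: complex^'n^'n) + norm A * norm (?X k)"
      using norm_triangle_ineq4[of "mat 1" "A ** ?X k"] norm_matrix_mult_le[of A "?X k"] by linarith
    finally have "(real k - norm A) * norm (?X k) \<le> norm (mat 1 :: complex^'n^'n)"
      by (simp add: algebra_simps)
    moreover have "1 * norm (?X k) \<le> (real k - norm A) * norm (?X k)"
      using N False by (intro mult_right_mono) auto
    ultimately have "norm (?X k) \<le> norm (mat 1 :: complex^'n^'n)" by simp
    then show ?thesis by (simp add: add_increasing2 sum_nonneg)
  qed
  moreover have "?K \<ge> 0" by (intro add_nonneg_nonneg sum_nonneg) auto
  ultimately show ?thesis by blast
qed

text \<open>The inverse is a product of \<open>m\<close> inverses with one common bound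
  \<open>K\<close>.\<close>

lemma geom_bounded_matrix_inv_pochhammer:
  fixes A :: "complex^'n^'n"
  assumes "\<And>k::nat. invertible (A + mat (of_nat k))"
  shows "geom_bounded (\<lambda>m. matrix_inv (mat_pochhammer A m))"
proof -
  obtain K where K: "K \<ge> 0" "\<And>k::nat. norm (matrix_inv (A + mat (of_nat k))) \<le> K"
    using bounded_matrix_inv_add_of_nat[OF assms] by auto
  have "norm (matrix_inv (mat_pochhammer A m)) \<le> norm (mat 1 :: complex^'n^'n) * K ^ m" for m
  proof (induction m)
    case 0
    have "matrix_inv (mat 1 :: complex^'n^'n) = mat 1" by (rule matrix_inv_eq) simp
    then show ?case by simp
  next
    case (Suc m)
    have "norm (matrix_inv (mat_pochhammer A (Suc m)))
        \<le> norm (matrix_inv (A + mat (of_nat m))) * norm (matrix_inv (mat_pochhammer A m))"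
      by (simp add: matrix_inv_mult assms invertible_mat_pochhammer norm_matrix_mult_le)
    also have "\<dots> \<le> K * (norm (mat 1 :: complex^'n^'n) * K ^ m)"
      by (intro mult_mono K Suc) auto
    finally show ?case by (simp add: mult_ac)
  qed
  then show ?thesis by (rule geom_boundedI)
qed

lemma matrix_inv_mat_Gamma_add_of_nat:
  fixes A :: "complex^'n^'n"
  assumes "positive_stable A" "\<And>k::nat. invertible (A + mat (of_nat k))"
  shows "matrix_inv (mat_Gamma (A + mat (of_nat m))) = matrix_inv (mat_Gamma A) ** matrix_inv (mat_pochhammer A m)"
  unfolding mat_Gamma_add_of_nat[OF assms(1)]
  by (intro matrix_inv_mult invertible_mat_pochhammer invertible_mat_Gamma assms)

section \<open>Incomplete Gamma integrals\<close>

lemma set_integrable_gamma_kernel_subset: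
  fixes A :: "complex^'n^'n"
  assumes "positive_stable A" "S \<in> sets borel" "S \<subseteq> {0<..}"
  shows "set_integrable lborel S (gamma_kernel A)"
  using assms by (intro set_integrable_subset[OF set_integrable_gamma_kernel]) auto

lemma mat_lower_add_upper:
  fixes A :: "complex^'n^'n"
  assumes "positive_stable A" "x > 0"
  shows "mat_lower_gamma A x + mat_upper_Gamma A x = mat_Gamma A"
proof -
  have "{0<..x} \<union> {x<..} = {0<..}" "{0<..x} \<inter> {x<..} = {}" using assms by auto
  moreover have "set_integrable lborel {0<..x} (gamma_kernel A)" "set_integrable lborel {x<..} (gamma_kernel A)"
    using assms by (auto intro: set_integrable_gamma_kernel_subset)
  ultimately show ?thesis
    using set_integral_Un[of "{0<..x}" "{x<..}" lborel "gamma_kernel A"]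
    by (simp only: mat_Gamma_eq mat_lower_gamma_eq mat_upper_Gamma_eq)
qed

text \<open>Raising \<open>A\<close> by \<open>m\<close> multiplies the kernel by
  \<open>s ^ m\<close>, which is at most \<open>x ^ m\<close> on the interval of
  integration.\<close>

lemma norm_mat_lower_gamma_le:
  fixes A :: "complex^'n^'n"
  assumes "positive_stable A"
  shows "\<exists>C\<ge>0. \<forall>m. norm (mat_lower_gamma (A + mat (of_nat m)) x) \<le> C * x ^ m"
proof (cases "x > 0")
  case False
  \<comment> \<open>The integral over the empty interval is 0, and the constant 0 is right even
    where \<open>x ^ m\<close> is negative.\<close>
  then have "{0<..x} = {}" by auto
  then show ?thesis
    by (intro exI[of _ 0]) (simp add: mat_lower_gamma_def set_lebesgue_integral_def)
next
  case True
  let ?C = "LBINT s:{0<..x}. norm (gamma_kernel A s)"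
  have int: "set_integrable lborel {0<..x} (gamma_kernel A)"
    using assms by (intro set_integrable_gamma_kernel_subset) auto
  have "norm (mat_lower_gamma (A + mat (of_nat m)) x) \<le> ?C * x ^ m" for m
  proof -
    have int': "set_integrable lborel {0<..x} (gamma_kernel (A + mat (of_nat m)))"
      using assms by (intro set_integrable_gamma_kernel_subset positive_stable_add) auto
    have "norm (mat_lower_gamma (A + mat (of_nat m)) x)
        \<le> (LBINT s:{0<..x}. norm (gamma_kernel (A + mat (of_nat m)) s))"
      unfolding mat_lower_gamma_eq by (rule set_integral_norm_bound[OF int'])
    also have "\<dots> \<le> (LBINT s:{0<..x}. norm (gamma_kernel A s) * x ^ m)"
      using int int'
      by (intro set_integral_mono set_integrable_norm set_integrable_mult_left)
         (auto simp: gamma_kernel_add_of_nat mult.commute intro!: mult_right_mono power_mono)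
    finally show ?thesis by simp
  qed
  moreover have "?C \<ge> 0"
    unfolding set_lebesgue_integral_def by (intro Bochner_Integration.integral_nonneg) auto
  ultimately show ?thesis by blast
qed

text \<open>The fundamental theorem of calculus for gauge integrals over \<open>{0..u}\<close>,
  which differs from the interval of integration by at most the point 0.\<close>

lemma mat_lower_gamma_has_vector_derivative:
  fixes A :: "complex^'n^'n"
  assumes "positive_stable A" "x > 0"
  shows "(mat_lower_gamma A has_vector_derivative gamma_kernel A x) (at x)"
proof -
  have int: "gamma_kernel A integrable_on {0..u}" and
    eq: "mat_lower_gamma A u = integral {0..u} (gamma_kernel A)" for u
  proof -
    have "set_integrable lborel {0<..u} (gamma_kernel A)"
      using assms by (intro set_integrable_gamma_kernel_subset) auto
    note * = set_borel_integral_eq_integral[OF this]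
    have n: "negligible (({0..u} - {0<..u}) \<union> ({0<..u} - {0..u}))"
      by (rule negligible_subset[of "{0}"]) auto
    show "gamma_kernel A integrable_on {0..u}"
      by (rule integrable_spike_set[OF *(1)]) (auto intro: negligible_subset[OF n])
    have "integral {0<..u} (gamma_kernel A) = integral {0..u} (gamma_kernel A)"
      by (rule integral_spike_set) (auto intro: negligible_subset[OF n])
    then show "mat_lower_gamma A u = integral {0..u} (gamma_kernel A)"
      using * by (simp add: mat_lower_gamma_eq)
  qed
  \<comment> \<open>The right end \<open>x + 1\<close> makes \<open>x\<close> an interior point, so
    the derivative is two-sided; the exceptional set of the theorem is empty.\<close>
  have "((\<lambda>u. integral {0..u} (gamma_kernel A)) has_vector_derivative gamma_kernel A x)
      (at x within ({0..x + 1} - {}))"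
    using assms by (intro integral_has_vector_derivative_continuous_at int)
      (auto intro: continuous_at_imp_continuous_at_within gamma_kernel_isCont)
  then show ?thesis
    using assms by (simp add: eq[abs_def] at_within_Icc_at)
qed

section \<open>The incomplete exponential functions\<close>

text \<open>The Weierstrass M-test gives uniform convergence of the derivatives. A domination on
  \<open>S\<close> suffices, so that a compact interval can be used.\<close>

lemma has_vector_derivative_suminf:
  fixes f :: "nat \<Rightarrow> real \<Rightarrow> 'b::banach"
  assumes "convex S"
    and f': "\<And>n y. y \<in> S \<Longrightarrow> (f n has_vector_derivative f' n y) (at y within S)"
    and le: "\<And>n y. y \<in> S \<Longrightarrow> norm (f' n y) \<le> M n"
    and "summable M"
    and x: "x \<in> S" "summable (\<lambda>n. f n x)"
  shows "((\<lambda>y. \<Sum>n. f n y) has_vector_derivative (\<Sum>n. f' n x)) (at x within S)"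
proof -
  have lim: "uniform_limit S (\<lambda>n y. \<Sum>i<n. f' i y) (\<lambda>y. \<Sum>i. f' i y) sequentially"
    using le \<open>summable M\<close> by (rule Weierstrass_m_test)
  have "\<exists>g. \<forall>y\<in>S. (\<lambda>n. f n y) sums g y \<and> (g has_derivative (\<lambda>h. h *\<^sub>R (\<Sum>i. f' i y))) (at y within S)"
  proof (rule has_derivative_series)
    show "convex S" "x \<in> S" "(\<lambda>n. f n x) sums (\<Sum>n. f n x)"
      using assms by (auto intro: summable_sums)
    show "(f n has_derivative (\<lambda>h. h *\<^sub>R f' n y)) (at y within S)" if "y \<in> S" for n y
      using f'[OF that] by (simp add: has_vector_derivative_def)
    fix e :: real assume "e > 0"
    from uniform_limitD[OF lim this]
    show "\<forall>\<^sub>F n in sequentially. \<forall>y\<in>S. \<forall>h.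
        norm ((\<Sum>i<n. h *\<^sub>R f' i y) - h *\<^sub>R (\<Sum>i. f' i y)) \<le> e * norm h"
    proof eventually_elim
      case (elim n)
      have "norm ((\<Sum>i<n. h *\<^sub>R f' i y) - h *\<^sub>R (\<Sum>i. f' i y))
          = norm h * norm ((\<Sum>i<n. f' i y) - (\<Sum>i. f' i y))" for h y
        by (simp flip: scaleR_sum_right scaleR_diff_right)
      moreover have "norm h * norm ((\<Sum>i<n. f' i y) - (\<Sum>i. f' i y)) \<le> norm h * e" if "y \<in> S" for h :: real and y
        using elim that by (intro mult_left_mono) (auto simp: dist_norm intro: less_imp_le)
      ultimately show ?case by (simp only: mult.commute[of e]) blast
    qed
  qed
  then obtain g where g: "\<And>y. y \<in> S \<Longrightarrow> (\<lambda>n. f n y) sums g y"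
    "\<And>y. y \<in> S \<Longrightarrow> (g has_vector_derivative (\<Sum>i. f' i y)) (at y within S)"
    by (auto simp: has_vector_derivative_def)
  show ?thesis
    by (rule has_vector_derivative_transform[OF x(1) _ g(2)[OF x(1)]]) (use g(1) in \<open>simp add: sums_iff\<close>)
qed

section \<open>Coefficient sequences of the two functions\<close>

lemma geom_bounded_mult:
  assumes "geom_bounded c" "geom_bounded d"
  shows "geom_bounded (\<lambda>m. c m ** d m)"
proof -
  obtain C K D L where c: "\<And>m. norm (c m) \<le> C * K ^ m" and d: "\<And>m. norm (d m) \<le> D * L ^ m"
    using assms unfolding geom_bounded_def by metis
  have "norm (c m ** d m) \<le> (C * D) * (K * L) ^ m" for m
  proof -
    have "norm (c m ** d m) \<le> norm (c m) * norm (d m)" by (rule norm_matrix_mult_le)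
    also have "\<dots> \<le> (C * K ^ m) * (D * L ^ m)"
      using order_trans[OF norm_ge_zero c] by (intro mult_mono c d) auto
    finally show ?thesis by (simp add: power_mult_distrib mult_ac)
  qed
  then show ?thesis by (rule geom_boundedI)
qed

lemma geom_bounded_const: "geom_bounded (\<lambda>_. M)"
  by (rule geom_boundedI[where C = "norm M" and K = 1]) simp

lemma geom_bounded_diff:
  assumes "geom_bounded c" "geom_bounded d"
  shows "geom_bounded (\<lambda>m. c m - d m)"
proof -
  obtain C K D L where c: "\<And>m. norm (c m) \<le> C * K ^ m" and d: "\<And>m. norm (d m) \<le> D * L ^ m"
    using assms unfolding geom_bounded_def by metis
  \<comment> \<open>The signs of \<open>K\<close> and \<open>L\<close> are unknown, so a common rate
    is formed from absolute values.\<close>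
  define R where "R = max \<bar>K\<bar> \<bar>L\<bar>"
  have le: "B * Q ^ m \<le> \<bar>B\<bar> * R ^ m" if "\<bar>Q\<bar> \<le> R" for B Q :: real and m
  proof -
    have "B * Q ^ m \<le> \<bar>B\<bar> * \<bar>Q\<bar> ^ m" by (metis abs_ge_self abs_mult power_abs)
    also have "\<dots> \<le> \<bar>B\<bar> * R ^ m" using that by (intro mult_left_mono power_mono) auto
    finally show ?thesis .
  qed
  have "norm (c m - d m) \<le> (\<bar>C\<bar> + \<bar>D\<bar>) * R ^ m" for m
    using norm_triangle_ineq4[of "c m" "d m"] c[of m] d[of m] le[of K C m] le[of L D m]
    by (simp add: R_def distrib_right)
  then show ?thesis by (rule geom_boundedI)
qed

lemma exp_series_diff:
  assumes "geom_bounded c" "geom_bounded d"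
  shows "exp_series (\<lambda>m. c m - d m) t = exp_series c t - exp_series d t"
  unfolding exp_series_def
  by (simp add: cscale.diff_right suminf_diff geom_bounded_summable assms)

definition lower_coeff :: "complex^'n^'n \<Rightarrow> real \<Rightarrow> nat \<Rightarrow> complex^'n^'n"
  where "lower_coeff A x m = matrix_inv (mat_Gamma (A + mat (of_nat m))) ** mat_lower_gamma (A + mat (of_nat m)) x"

definition upper_coeff :: "complex^'n^'n \<Rightarrow> real \<Rightarrow> nat \<Rightarrow> complex^'n^'n"
  where "upper_coeff A x m = matrix_inv (mat_Gamma (A + mat (of_nat m))) ** mat_upper_Gamma (A + mat (of_nat m)) x"

lemma inc_exp_lower_eq: "inc_exp_lower x t A = exp_series (lower_coeff A x) t"
  and inc_exp_upper_eq: "inc_exp_upper x t A = exp_series (upper_coeff A x) t"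
  by (simp_all add: inc_exp_lower_def inc_exp_upper_def exp_series_def lower_coeff_def upper_coeff_def)

text \<open>Replacing \<open>A\<close> by \<open>A + n I\<close> shifts the coefficients by
  \<open>n\<close>, exactly as \<open>n\<close> differentiations in \<open>t\<close> do.\<close>

lemma coeff_shift:
  "lower_coeff (A + mat (of_nat n)) x = (\<lambda>m. lower_coeff A x (m + n))"
  "upper_coeff (A + mat (of_nat n)) x = (\<lambda>m. upper_coeff A x (m + n))"
proof -
  have "A + mat (of_nat n) + mat (of_nat m) = A + mat (of_nat (m + n))" for m
    by (simp add: mat_add add.assoc add.commute[of "mat (of_nat n)"])
  then show "lower_coeff (A + mat (of_nat n)) x = (\<lambda>m. lower_coeff A x (m + n))"
    "upper_coeff (A + mat (of_nat n)) x = (\<lambda>m. upper_coeff A x (m + n))"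
    by (simp_all only: lower_coeff_def[abs_def] upper_coeff_def[abs_def])
qed

lemma mat_0F1_eq: "mat_0F1 A z = exp_series (\<lambda>m. matrix_inv (mat_pochhammer A m)) z"
  by (simp add: mat_0F1_def exp_series_def)

lemma geom_bounded_lower_coeff:
  fixes A :: "complex^'n^'n"
  assumes "positive_stable A" "\<And>k::nat. invertible (A + mat (of_nat k))"
  shows "geom_bounded (lower_coeff A x)"
proof -
  obtain C where "\<And>m. norm (mat_lower_gamma (A + mat (of_nat m)) x) \<le> C * x ^ m"
    using norm_mat_lower_gamma_le[OF assms(1)] by blast
  then have "geom_bounded (\<lambda>m. mat_lower_gamma (A + mat (of_nat m)) x)"
    by (rule geom_boundedI)
  then show ?thesis
    unfolding lower_coeff_def[abs_def] matrix_inv_mat_Gamma_add_of_nat[OF assms]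
    by (intro geom_bounded_mult geom_bounded_const geom_bounded_matrix_inv_pochhammer assms)
qed

text \<open>The two incomplete integrals add up to the full one, which its inverse cancels. This
  transfers results from the lower to the upper function.\<close>

lemma upper_coeff_eq:
  fixes A :: "complex^'n^'n"
  assumes "positive_stable A" "x > 0"
  shows "upper_coeff A x = (\<lambda>m. mat 1 - lower_coeff A x m)"
proof
  fix m
  have ps: "positive_stable (A + mat (of_nat m))"
    using assms by (simp add: positive_stable_add)
  have "mat_upper_Gamma (A + mat (of_nat m)) x = mat_Gamma (A + mat (of_nat m)) - mat_lower_gamma (A + mat (of_nat m)) x"
    using mat_lower_add_upper[OF ps assms(2)] by (simp add: algebra_simps)
  then show "upper_coeff A x m = mat 1 - lower_coeff A x m"
    using matrix_inv_left[OF invertible_mat_Gamma[OF ps]]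
    by (simp add: upper_coeff_def lower_coeff_def mmult.diff_right)
qed

text \<open>Termwise differentiation on a compact neighbourhood \<open>S\<close> of \<open>x\<close>
  in the positive half-line. There the kernel is bounded, and the remaining series is dominated by
  its value in norm at the right end \<open>2 * x\<close>.\<close>

lemma inc_exp_lower_has_vector_derivative:
  fixes A :: "complex^'n^'n" and t :: complex
  assumes A: "positive_stable A" "\<And>k::nat. invertible (A + mat (of_nat k))" and "x > 0"
  shows "((\<lambda>x. inc_exp_lower x t A) has_vector_derivative
            exp (- x) *\<^sub>R (mat_powr x (A - mat 1) ** matrix_inv (mat_Gamma A)
              ** mat_0F1 A (t * of_real x))) (at x)"
proof -
  define G where "G = matrix_inv (mat_Gamma A)"
  define P where "P m = matrix_inv (mat_pochhammer A m)" for m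
  define f where "f m y = (t ^ m / fact m) *\<^sub>C lower_coeff A y m" for m y
  define f' where "f' m y = G ** (((t * of_real y) ^ m / fact m) *\<^sub>C P m) ** gamma_kernel A y" for m y
  define S where "S = {x / 2..2 * x}"
  have pos: "y > 0" if "y \<in> S" for y
    using that \<open>x > 0\<close> by (auto simp: S_def)
  have P: "geom_bounded P"
    unfolding P_def[abs_def] by (rule geom_bounded_matrix_inv_pochhammer[OF A(2)])
  have "continuous_on S (gamma_kernel A)"
    using pos by (intro continuous_at_imp_continuous_on ballI gamma_kernel_isCont) auto
  then have "bounded (gamma_kernel A ` S)"
    by (intro compact_imp_bounded compact_continuous_image) (auto simp: S_def)
  then obtain B where B: "\<And>y. y \<in> S \<Longrightarrow> norm (gamma_kernel A y) \<le> B"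
    by (auto simp: bounded_iff)
  have "((\<lambda>y. \<Sum>m. f m y) has_vector_derivative (\<Sum>m. f' m x)) (at x within S)"
  proof (rule has_vector_derivative_suminf[where M = "\<lambda>m. norm G * norm (((t * of_real (2 * x)) ^ m / fact m) *\<^sub>C P m) * B"])
    show "convex S" "x \<in> S" using \<open>x > 0\<close> by (auto simp: S_def)
    show "(f m has_vector_derivative f' m y) (at y within S)" if "y \<in> S" for m y
    proof -
      have ps: "positive_stable (A + mat (of_nat m))"
        using A by (simp add: positive_stable_add)
      have "(f m has_vector_derivative
          (t ^ m / fact m) *\<^sub>C (G ** P m ** gamma_kernel (A + mat (of_nat m)) y)) (at y)"
        unfolding f_def lower_coeff_def matrix_inv_mat_Gamma_add_of_nat[OF A] G_def P_def
        by (intro bounded_linear.has_vector_derivative[OF cscale.bounded_linear_right]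
            bounded_linear.has_vector_derivative[OF mmult.bounded_linear_right]
            mat_lower_gamma_has_vector_derivative ps pos that)
      \<comment> \<open>The factor \<open>y ^ m\<close> of the raised kernel joins
        \<open>t ^ m\<close>, which produces the argument \<open>t y\<close> of the hypergeometric
        series.\<close>
      moreover have "(t ^ m / fact m) *\<^sub>C (G ** P m ** gamma_kernel (A + mat (of_nat m)) y) = f' m y"
        by (simp add: f'_def gamma_kernel_add_of_nat pos that scaleR_eq_cscale cscale_mult_left cscale_mult_right
            cscale_cscale power_mult_distrib)
      ultimately show ?thesis by (simp add: has_vector_derivative_at_within)
    qed
    show "norm (f' m y) \<le> norm G * norm (((t * of_real (2 * x)) ^ m / fact m) *\<^sub>C P m) * B"
      if "y \<in> S" for m y
    proof -
      have "norm (((t * of_real y) ^ m / fact m) *\<^sub>C P m) \<le> norm (((t * of_real (2 * x)) ^ m / fact m) *\<^sub>C P m)"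
        using that pos[OF that]
        by (auto simp: norm_divide norm_power norm_mult S_def intro!: mult_right_mono divide_right_mono power_mono mult_left_mono)
      then have "norm (G ** (((t * of_real y) ^ m / fact m) *\<^sub>C P m)) \<le> norm G * norm (((t * of_real (2 * x)) ^ m / fact m) *\<^sub>C P m)"
        by (intro order_trans[OF norm_matrix_mult_le] mult_left_mono) auto
      then have "norm (G ** (((t * of_real y) ^ m / fact m) *\<^sub>C P m)) * norm (gamma_kernel A y)
          \<le> norm G * norm (((t * of_real (2 * x)) ^ m / fact m) *\<^sub>C P m) * B"
        by (rule mult_mono[OF _ B[OF that]]) simp_all
      then show ?thesis
        unfolding f'_def by (rule order_trans[OF norm_matrix_mult_le])
    qed
    show "summable (\<lambda>m. norm G * norm (((t * of_real (2 * x)) ^ m / fact m) *\<^sub>C P m) * B)"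
      by (intro summable_mult summable_mult2 geom_bounded_summable_norm P)
    show "summable (\<lambda>m. f m x)"
      unfolding f_def by (intro geom_bounded_summable geom_bounded_lower_coeff A)
  qed
  moreover have "(\<lambda>m. f' m x) sums (G ** mat_0F1 A (t * of_real x) ** gamma_kernel A x)"
    unfolding f'_def mat_0F1_eq P_def[symmetric]
    by (intro bounded_linear.sums[OF mmult.bounded_linear_left] bounded_linear.sums[OF mmult.bounded_linear_right]
        exp_series_sums P)
  moreover have "at x within S = at x"
    using \<open>x > 0\<close> unfolding S_def by (intro at_within_Icc_at) auto
  moreover have "(\<lambda>y. \<Sum>m. f m y) = (\<lambda>y. inc_exp_lower y t A)"
    by (simp add: f_def inc_exp_lower_eq exp_series_def)
  \<comment> \<open>Termwise differentiation leaves the kernel as the rightmost factor. It commutes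
    with \<open>G\<close> and with every inverse Pochhammer symbol, hence with their series, and so
    moves to the front.\<close>
  moreover have "G ** mat_0F1 A (t * of_real x) ** gamma_kernel A x
      = exp (- x) *\<^sub>R (mat_powr x (A - mat 1) ** G ** mat_0F1 A (t * of_real x))"
  proof -
    let ?K = "gamma_kernel A x"
    have G: "G ** ?K = ?K ** G"
      unfolding G_def
      by (intro matrix_inv_commute invertible_mat_Gamma mat_Gamma_commute A gamma_kernel_commute[symmetric] refl)
    have "P m ** ?K = ?K ** P m" for m
      unfolding P_def
      by (intro matrix_inv_commute invertible_mat_pochhammer A mat_pochhammer_commute gamma_kernel_commute[symmetric] refl)
    then have eq: "(\<lambda>m. ?K ** (((t * of_real x) ^ m / fact m) *\<^sub>C P m))
        = (\<lambda>m. (((t * of_real x) ^ m / fact m) *\<^sub>C P m) ** ?K)"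
      by (simp add: cscale_mult_left cscale_mult_right)
    have "mat_0F1 A (t * of_real x) ** ?K = ?K ** mat_0F1 A (t * of_real x)"
      unfolding mat_0F1_eq P_def[symmetric]
    proof (rule sums_unique2)
      show "(\<lambda>m. (((t * of_real x) ^ m / fact m) *\<^sub>C P m) ** ?K) sums (exp_series P (t * of_real x) ** ?K)"
        by (intro bounded_linear.sums[OF mmult.bounded_linear_left] exp_series_sums P)
      show "(\<lambda>m. (((t * of_real x) ^ m / fact m) *\<^sub>C P m) ** ?K) sums (?K ** exp_series P (t * of_real x))"
        unfolding eq[symmetric]
        by (intro bounded_linear.sums[OF mmult.bounded_linear_right] exp_series_sums P)
    qed
    then have "G ** mat_0F1 A (t * of_real x) ** ?K = (?K ** G) ** mat_0F1 A (t * of_real x)"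
      by (metis G matrix_mul_assoc)
    then show ?thesis by (simp add: gamma_kernel_def mmult.scaleR_left)
  qed
  ultimately show ?thesis
    by (simp add: sums_iff G_def)
qed

theorem theorem3p2:
  fixes A :: "complex ^ 'n ^ 'n" and x :: real and t :: complex
  assumes "positive_stable A"
    and "\<And>k::nat. invertible (A + mat (of_nat k))"
    and "x > 0"
  shows "(\<forall>n::nat. n \<ge> 1 \<longrightarrow>
            has_nth_complex_derivative n (\<lambda>t. inc_exp_lower x t A)
              (inc_exp_lower x t (A + mat (of_nat n))) t \<and>
            has_nth_complex_derivative n (\<lambda>t. inc_exp_upper x t A)
              (inc_exp_upper x t (A + mat (of_nat n))) t) \<and>
         ((\<lambda>x. inc_exp_lower x t A) has_vector_derivative
            exp (- x) *\<^sub>R (mat_powr x (A - mat 1) ** matrix_inv (mat_Gamma A)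
              ** mat_0F1 A (t * of_real x))) (at x) \<and>
         ((\<lambda>x. inc_exp_upper x t A) has_vector_derivative
            - (exp (- x) *\<^sub>R (mat_powr x (A - mat 1) ** matrix_inv (mat_Gamma A)
              ** mat_0F1 A (t * of_real x)))) (at x)"
proof (intro conjI allI impI)
  note lower = geom_bounded_lower_coeff[OF assms(1,2)]
  note D = inc_exp_lower_has_vector_derivative[OF assms, of t]
  fix n :: nat
  show "has_nth_complex_derivative n (\<lambda>t. inc_exp_lower x t A)
      (inc_exp_lower x t (A + mat (of_nat n))) t"
    unfolding inc_exp_lower_eq coeff_shift
    by (rule exp_series_has_nth_complex_derivative[OF lower])
  have upper: "geom_bounded (upper_coeff A x)"
    unfolding upper_coeff_eq[OF assms(1,3)] by (intro geom_bounded_diff geom_bounded_const lower)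
  show "has_nth_complex_derivative n (\<lambda>t. inc_exp_upper x t A)
      (inc_exp_upper x t (A + mat (of_nat n))) t"
    unfolding inc_exp_upper_eq coeff_shift
    by (rule exp_series_has_nth_complex_derivative[OF upper])
  show "((\<lambda>x. inc_exp_lower x t A) has_vector_derivative
      exp (- x) *\<^sub>R (mat_powr x (A - mat 1) ** matrix_inv (mat_Gamma A)
        ** mat_0F1 A (t * of_real x))) (at x)"
    by (rule D)
  \<comment> \<open>The series with constant coefficients \<open>mat 1\<close> is independent of
    \<open>y\<close> and drops out of the derivative. The identity holds on the open half-line,
    which is a neighbourhood of \<open>x\<close>.\<close>
  have eq: "inc_exp_upper y t A = exp_series (\<lambda>_. mat 1) t - inc_exp_lower y t A" if "y > 0" for y
    unfolding inc_exp_upper_eq inc_exp_lower_eq upper_coeff_eq[OF assms(1) that]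
    by (rule exp_series_diff[OF geom_bounded_const geom_bounded_lower_coeff[OF assms(1,2)]])
  have "((\<lambda>y. exp_series (\<lambda>_. mat 1) t - inc_exp_lower y t A) has_vector_derivative
      0 - exp (- x) *\<^sub>R (mat_powr x (A - mat 1) ** matrix_inv (mat_Gamma A)
        ** mat_0F1 A (t * of_real x))) (at x)"
    by (intro has_vector_derivative_diff has_vector_derivative_const D)
  then show "((\<lambda>x. inc_exp_upper x t A) has_vector_derivative
      - (exp (- x) *\<^sub>R (mat_powr x (A - mat 1) ** matrix_inv (mat_Gamma A)
        ** mat_0F1 A (t * of_real x)))) (at x)"
    using assms(3) eq
    by (subst has_vector_derivative_transform_within_open[where S = "{0<..}"]) auto
qed

end
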